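(* Suppose maximum-ratio (MR) combining based on the phase-aware MMSE estimator is used, i.e. $v_{m,k}=\hat h^{\mathrm{mmse}}_{m,k}$ for all $m,k$. Fix a UE $k$ and a nonzero LSFD vector $\mathbf a_k=[\alpha_{1,k},\dots,\alpha_{M,k}]^T\in\mathbb C^M$, and put $\mathbf A_k=\mathrm{diag}(\alpha_{1,k},\dots,\alpha_{M,k})$. Then $\mathrm{SE}^{\mathrm{ul}}_k=\frac{\tau_u}{\tau_c}\log_2(1+\gamma^{\mathrm{ul,mmse}}_k)$ with $$\gamma^{\mathrm{ul,mmse}}_k=\frac{p_k|\mathrm{tr}(\mathbf A_k\mathbf Z_k)|^2}{\sum_{l=1}^K p_l\,\mathrm{tr}(\mathbf A_k^H\mathbf R'_l\mathbf Z_k\mathbf A_k)+\sum_{l\in\mathcal P_k\setminus\{k\}}p_l\hat p_k\hat p_l\tau_p^2|\mathrm{tr}(\mathbf A_k\mathbf R_l\boldsymbol\Lambda_k\mathbf R_k)|^2+\mathrm{tr}\big(\mathbf A_k^H(\sigma^2_{\mathrm{ul}}\mathbf Z_k-p_k\mathbf L_k^2)\mathbf A_k\big)},$$ where $\mathbf Z_k=\hat p_k\tau_p\boldsymbol\Omega_k+\mathbf L_k$. Equivalently, in Rayleigh quotient form, $$\gamma^{\mathrm{ul,mmse}}_k=\frac{p_k\,\mathbf a_k^H\mathbf b_k\mathbf b_k^H\mathbf a_k}{\mathbf a_k^H\boldsymbol\Gamma_k\mathbf a_k},$$ where $$\boldsymbol\Gamma_k=\sum_{l=1}^K p_l\mathbf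 R'_l\mathbf Z_k+\sum_{l\in\mathcal P_k\setminus\{k\}}p_l\hat p_k\hat p_l\tau_p^2\,\mathbf z_{k,l}\mathbf z_{k,l}^H-p_k\mathbf L_k^2+\sigma^2_{\mathrm{ul}}\mathbf Z_k,$$ $\mathbf b_k=\mathrm{diag}(\mathbf Z_k)$ and $\mathbf z_{k,l}=\mathrm{diag}(\mathbf R_l\boldsymbol\Lambda_k\mathbf R_k)$ (vectors of diagonal entries). The LSFD vector $\mathbf a_k=\boldsymbol\Gamma_k^{-1}\mathbf b_k$ maximizes $\mathrm{SE}^{\mathrm{ul}}_k$ over $\mathbf a_k$, and with this vector $$\mathrm{SE}^{\mathrm{ul}}_k=\frac{\tau_u}{\tau_c}\log_2\left(1+p_k\mathbf b_k^H\boldsymbol\Gamma_k^{-1}\mathbf b_k\right).$$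
   Context: Channels. There are $M$ single-antenna access points (APs) and $K$ single-antenna users (UEs). The channel between AP $m$ and UE $k$ is $h_{m,k}=\bar h_{m,k}e^{j\varphi_{m,k}}+g_{m,k}$, with $\bar h_{m,k}\ge 0$ deterministic, $\varphi_{m,k}$ uniform on $[-\pi,\pi]$, $g_{m,k}\sim\mathcal N_{\mathbb C}(0,\beta_{m,k})$ (circularly symmetric complex Gaussian), $\beta_{m,k}>0$; all $\varphi_{m,k},g_{m,k}$ are mutually independent over $m,k$. Write $\mathbf h_k=[h_{1,k},\dots,h_{M,k}]^T$. Pilots. $\tau_c$ is the coherence block length, $\tau_p<K$ the pilot length, $\tau_u\le\tau_c-\tau_p$ the number of uplink data symbols. Each UE uses one of $\tau_p$ mutually orthogonal pilot sequences $\boldsymbol\phi_k\in\mathbb C^{\tau_p}$ with $\|\boldsymbol\phi_k\|^2=\tau_p$, with pilot power $\hat p_k>0$. $\mathcal P_k$ is the set of UEs using the same pilot as UE $k$ (including $k$). After correlation with the pilot, AP $m$ has $$y^p_{m,k}=\sum_{l\in\mathcal P_k}\sqrt{\hat p_l}\,\tau_p h_{m,l}+\boldsymbol\phi_k^H\mathbf n^p_m,$$ where the $\mathbf n^p_m\sim\mathcal N_{\mathbb C}(\mathbf 0,\sigma^2_{\mathrm{ul}}\mathbf I_{\tau_p})$ are independent over $m$ and independent of all channels, and $\sigma^2_{\mathrm{ul}}>0$. Phase-aware MMSE estimator (phases known at the AP): $$\hat h^{\mathrm{mmse}}_{m,k}=\bar h_{m,k}e^{j\varphi_{m,k}}+\frac{\sqrt{\hat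 p_k}\,\beta_{m,k}(y^p_{m,k}-\bar y^p_{m,k})}{\lambda_{m,k}},$$ with $\bar y^p_{m,k}=\sum_{l\in\mathcal P_k}\sqrt{\hat p_l}\tau_p\bar h_{m,l}e^{j\varphi_{m,l}}$ and $\lambda_{m,k}=\sum_{l\in\mathcal P_k}\hat p_l\tau_p\beta_{m,l}+\sigma^2_{\mathrm{ul}}$. Matrices (all $M\times M$ diagonal): $\mathbf R_k=\mathrm{diag}(\beta_{1,k},\dots,\beta_{M,k})$, $\mathbf L_k=\mathrm{diag}(\bar h_{1,k}^2,\dots,\bar h_{M,k}^2)$, $\mathbf R'_k=\mathbf R_k+\mathbf L_k$, $\boldsymbol\Lambda_k=\mathrm{diag}(\lambda_{1,k},\dots,\lambda_{M,k})^{-1}$, $\boldsymbol\Omega_k=\mathbf R_k\boldsymbol\Lambda_k\mathbf R_k$. For a diagonal matrix $\mathbf D$, $\mathrm{diag}(\mathbf D)$ is the column vector of its diagonal entries. Uplink spectral efficiency. UE $k$ transmits data with power $p_k\ge 0$. With combining vector $\mathbf v_k=[v_{1,k},\dots,v_{M,k}]^T$ and deterministic LSFD (large-scale fading decoding) coefficients $\alpha_{m,k}\in\mathbb C$, the (use-and-then-forget) uplink SE of UE $k$ is defined as $\mathrm{SE}^{\mathrm{ul}}_k=\frac{\tau_u}{\tau_c}\log_2(1+\gamma^{\mathrm{ul}}_k)$ with $$\gamma^{\mathrm{ul}}_k=\frac{p_k|\mathbb E\{\mathbf v_k^H\mathbf A_k^H\mathbf h_k\}|^2}{\sum_{l=1}^K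 p_l\mathbb E\{|\mathbf v_k^H\mathbf A_k^H\mathbf h_l|^2\}-p_k|\mathbb E\{\mathbf v_k^H\mathbf A_k^H\mathbf h_k\}|^2+\sigma^2_{\mathrm{ul}}\mathbb E\{\|\mathbf A_k\mathbf v_k\|^2\}},$$ expectations being over all randomness (channels, phases, pilot noise). *)

theory Defs
  imports "HOL-Probability.Probability"
begin

section \<open>Complex vectors and matrices\<close>

text \<open>\<open>herm_inner u w\<close> is $u^H w$, conjugate linear in its first argument.\<close>

definition herm_inner :: "complex^'n \<Rightarrow> complex^'n \<Rightarrow> complex" where
  "herm_inner u w = (\<Sum>i\<in>UNIV. cnj (u $ i) * w $ i)"

definition ctransp :: "complex^'n^'m \<Rightarrow> complex^'m^'n" where
  "ctransp A = (\<chi> i j. cnj (A $ j $ i))"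

definition diag_mat :: "complex^'n \<Rightarrow> complex^'n^'n" where
  "diag_mat d = (\<chi> i j. if i = j then d $ i else 0)"

definition diag_vec :: "complex^'n^'n \<Rightarrow> complex^'n" where
  "diag_vec D = (\<chi> i. D $ i $ i)"

text \<open>\<open>outer u w\<close> is $u w^H$.\<close>

definition outer :: "complex^'n \<Rightarrow> complex^'n \<Rightarrow> complex^'n^'n" where
  "outer u w = (\<chi> i j. u $ i * cnj (w $ j))"


section \<open>Circularly symmetric complex Gaussian variables\<close>

text \<open>$\mathcal{N}_{\mathbb{C}}(0,v)$ with $v > 0$ the total variance: each of the two independent
  real components has variance $v/2$, whereas \<open>normal_density\<close> expects a standard deviation.\<close>

definition circ_gaussian :: "'w measure \<Rightarrow> ('w \<Rightarrow> complex) \<Rightarrow> real \<Rightarrow> bool" where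
  "circ_gaussian P X v \<longleftrightarrow>
     prob_space.indep_var P borel (\<lambda>\<omega>. Re (X \<omega>)) borel (\<lambda>\<omega>. Im (X \<omega>)) \<and>
     distributed P lborel (\<lambda>\<omega>. Re (X \<omega>)) (normal_density 0 (sqrt (v / 2))) \<and>
     distributed P lborel (\<lambda>\<omega>. Im (X \<omega>)) (normal_density 0 (sqrt (v / 2)))"


section \<open>System model\<close>

text \<open>The type \<open>'m\<close> indexes the $M$ access points, \<open>'k\<close> the $K$ users and \<open>'t\<close> the $\tau_p$
  symbols of the pilot phase. As there are also $\tau_p$ pilot sequences, \<open>'t\<close> indexes them too:
  \<open>pilot S s\<close> is the sequence number \<open>s\<close>, and user \<open>k\<close> sends the sequence number \<open>pilot_of S k\<close>.\<close>

record ('m, 'k, 't::finite, 'w) uplink =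
  sample :: "'w measure"
  hbar :: "'m \<Rightarrow> 'k \<Rightarrow> real"
  beta :: "'m \<Rightarrow> 'k \<Rightarrow> real"
  phase :: "'m \<Rightarrow> 'k \<Rightarrow> 'w \<Rightarrow> real"
  gain :: "'m \<Rightarrow> 'k \<Rightarrow> 'w \<Rightarrow> complex"
  noise :: "'m \<Rightarrow> 'w \<Rightarrow> complex^'t"
  sigma2 :: real
  pilot :: "'t \<Rightarrow> complex^'t"
  pilot_of :: "'k \<Rightarrow> 't"
  phat :: "'k \<Rightarrow> real"
  pdata :: "'k \<Rightarrow> real"
  tau_c :: nat
  tau_u :: nat

definition tau_p :: "('m, 'k, 't::finite, 'w) uplink \<Rightarrow> real" where
  "tau_p S = real CARD('t)"

text \<open>Index set of the elementary sources of randomness. The real phases are embedded into the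
  complex numbers so that all sources form one family of mutually independent variables.\<close>

datatype ('m, 'k, 't) source = Phase 'm 'k | Gain 'm 'k | Noise 'm 't

fun source_rv :: "('m, 'k, 't::finite, 'w) uplink \<Rightarrow> ('m, 'k, 't) source \<Rightarrow> 'w \<Rightarrow> complex" where
  "source_rv S (Phase m k) \<omega> = complex_of_real (phase S m k \<omega>)"
| "source_rv S (Gain m k) \<omega> = gain S m k \<omega>"
| "source_rv S (Noise m t) \<omega> = noise S m \<omega> $ t"

locale cell_free_uplink = prob_space "sample S"
  for S :: "('m::finite, 'k::finite, 't::finite, 'w) uplink" +
  assumes hbar_nonneg: "hbar S m k \<ge> 0"
    and beta_pos: "beta S m k > 0"
    and sigma2_pos: "sigma2 S > 0"
    and phat_pos: "phat S k > 0"
    and pdata_nonneg: "pdata S k \<ge> 0"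
    and fewer_pilots: "CARD('t) < CARD('k)"
    and block_length: "tau_u S + CARD('t) \<le> tau_c S"
    and pilot_norm: "(norm (pilot S s))\<^sup>2 = tau_p S"
    and pilot_orth: "s \<noteq> s' \<Longrightarrow> herm_inner (pilot S s) (pilot S s') = 0"
    and phase_uniform:
      "distributed (sample S) lborel (phase S m k)
         (\<lambda>x. indicator {-pi..pi} x / measure lborel {-pi..pi})"
    and gain_gaussian: "circ_gaussian (sample S) (gain S m k) (beta S m k)"
    and noise_gaussian: "circ_gaussian (sample S) (\<lambda>\<omega>. noise S m \<omega> $ t) (sigma2 S)"
    and sources_indep: "indep_vars (\<lambda>_. borel) (source_rv S) UNIV"


section \<open>Channel estimation\<close>

definition chan :: "('m, 'k, 't::finite, 'w) uplink \<Rightarrow> 'm \<Rightarrow> 'k \<Rightarrow> 'w \<Rightarrow> complex" where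
  "chan S m k \<omega> = complex_of_real (hbar S m k) * cis (phase S m k \<omega>) + gain S m k \<omega>"

definition chan_vec :: "('m::finite, 'k, 't::finite, 'w) uplink \<Rightarrow> 'k \<Rightarrow> 'w \<Rightarrow> complex^'m" where
  "chan_vec S k \<omega> = (\<chi> m. chan S m k \<omega>)"

definition copilot :: "('m, 'k, 't::finite, 'w) uplink \<Rightarrow> 'k \<Rightarrow> 'k set" where
  "copilot S k = {l. pilot_of S l = pilot_of S k}"

definition y_pilot :: "('m, 'k::finite, 't::finite, 'w) uplink \<Rightarrow> 'm \<Rightarrow> 'k \<Rightarrow> 'w \<Rightarrow> complex" where
  "y_pilot S m k \<omega> =
     (\<Sum>l\<in>copilot S k. complex_of_real (sqrt (phat S l) * tau_p S) * chan S m l \<omega>)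
     + herm_inner (pilot S (pilot_of S k)) (noise S m \<omega>)"

definition y_pilot_mean ::
  "('m, 'k::finite, 't::finite, 'w) uplink \<Rightarrow> 'm \<Rightarrow> 'k \<Rightarrow> 'w \<Rightarrow> complex" where
  "y_pilot_mean S m k \<omega> =
     (\<Sum>l\<in>copilot S k.
        complex_of_real (sqrt (phat S l) * tau_p S * hbar S m l) * cis (phase S m l \<omega>))"

definition lam :: "('m, 'k::finite, 't::finite, 'w) uplink \<Rightarrow> 'm \<Rightarrow> 'k \<Rightarrow> real" where
  "lam S m k = (\<Sum>l\<in>copilot S k. phat S l * tau_p S * beta S m l) + sigma2 S"

definition mmse_est :: "('m, 'k::finite, 't::finite, 'w) uplink \<Rightarrow> 'm \<Rightarrow> 'k \<Rightarrow> 'w \<Rightarrow> complex" where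
  "mmse_est S m k \<omega> =
     complex_of_real (hbar S m k) * cis (phase S m k \<omega>)
     + complex_of_real (sqrt (phat S k) * beta S m k)
         * (y_pilot S m k \<omega> - y_pilot_mean S m k \<omega>) / complex_of_real (lam S m k)"

definition mr_mmse ::
  "('m::finite, 'k::finite, 't::finite, 'w) uplink \<Rightarrow> 'k \<Rightarrow> 'w \<Rightarrow> complex^'m" where
  "mr_mmse S k \<omega> = (\<chi> m. mmse_est S m k \<omega>)"


section \<open>Use-and-then-forget spectral efficiency\<close>

text \<open>In the following definitions \<open>v\<close> is the random combining vector of user \<open>k\<close> and \<open>a\<close> its
  LSFD vector.\<close>

definition desired_power ::
  "('m::finite, 'k::finite, 't::finite, 'w) uplink \<Rightarrow> ('w \<Rightarrow> complex^'m) \<Rightarrow> complex^'m \<Rightarrow> 'k \<Rightarrow> real"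
  where
  "desired_power S v a k =
     pdata S k *
       (cmod (\<integral>\<omega>. herm_inner (v \<omega>) (ctransp (diag_mat a) *v chan_vec S k \<omega>) \<partial>sample S))\<^sup>2"

definition interference_noise_power ::
  "('m::finite, 'k::finite, 't::finite, 'w) uplink \<Rightarrow> ('w \<Rightarrow> complex^'m) \<Rightarrow> complex^'m \<Rightarrow> 'k \<Rightarrow> real"
  where
  "interference_noise_power S v a k =
     (\<Sum>l\<in>UNIV. pdata S l *
        (\<integral>\<omega>. (cmod (herm_inner (v \<omega>) (ctransp (diag_mat a) *v chan_vec S l \<omega>)))\<^sup>2 \<partial>sample S))
     - desired_power S v a k
     + sigma2 S * (\<integral>\<omega>. (norm (diag_mat a *v v \<omega>))\<^sup>2 \<partial>sample S)"

definition sinr_ul ::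
  "('m::finite, 'k::finite, 't::finite, 'w) uplink \<Rightarrow> ('w \<Rightarrow> complex^'m) \<Rightarrow> complex^'m \<Rightarrow> 'k \<Rightarrow> real"
  where
  "sinr_ul S v a k = desired_power S v a k / interference_noise_power S v a k"

definition SE_ul ::
  "('m::finite, 'k::finite, 't::finite, 'w) uplink \<Rightarrow> ('w \<Rightarrow> complex^'m) \<Rightarrow> complex^'m \<Rightarrow> 'k \<Rightarrow> real"
  where
  "SE_ul S v a k = real (tau_u S) / real (tau_c S) * log 2 (1 + sinr_ul S v a k)"


section \<open>Closed-form expressions\<close>

definition R_mat :: "('m::finite, 'k, 't::finite, 'w) uplink \<Rightarrow> 'k \<Rightarrow> complex^'m^'m" where
  "R_mat S k = diag_mat (\<chi> m. complex_of_real (beta S m k))"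

definition L_mat :: "('m::finite, 'k, 't::finite, 'w) uplink \<Rightarrow> 'k \<Rightarrow> complex^'m^'m" where
  "L_mat S k = diag_mat (\<chi> m. complex_of_real ((hbar S m k)\<^sup>2))"

definition R'_mat :: "('m::finite, 'k, 't::finite, 'w) uplink \<Rightarrow> 'k \<Rightarrow> complex^'m^'m" where
  "R'_mat S k = R_mat S k + L_mat S k"

definition Lambda_mat ::
  "('m::finite, 'k::finite, 't::finite, 'w) uplink \<Rightarrow> 'k \<Rightarrow> complex^'m^'m" where
  "Lambda_mat S k = matrix_inv (diag_mat (\<chi> m. complex_of_real (lam S m k)))"

definition Omega_mat ::
  "('m::finite, 'k::finite, 't::finite, 'w) uplink \<Rightarrow> 'k \<Rightarrow> complex^'m^'m" where
  "Omega_mat S k = R_mat S k ** Lambda_mat S k ** R_mat S k"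

definition Z_mat :: "('m::finite, 'k::finite, 't::finite, 'w) uplink \<Rightarrow> 'k \<Rightarrow> complex^'m^'m" where
  "Z_mat S k = (phat S k * tau_p S) *\<^sub>R Omega_mat S k + L_mat S k"

definition b_vec :: "('m::finite, 'k::finite, 't::finite, 'w) uplink \<Rightarrow> 'k \<Rightarrow> complex^'m" where
  "b_vec S k = diag_vec (Z_mat S k)"

definition z_vec :: "('m::finite, 'k::finite, 't::finite, 'w) uplink \<Rightarrow> 'k \<Rightarrow> 'k \<Rightarrow> complex^'m" where
  "z_vec S k l = diag_vec (R_mat S l ** Lambda_mat S k ** R_mat S k)"

definition Gamma_mat ::
  "('m::finite, 'k::finite, 't::finite, 'w) uplink \<Rightarrow> 'k \<Rightarrow> complex^'m^'m" where
  "Gamma_mat S k =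
     (\<Sum>l\<in>UNIV. pdata S l *\<^sub>R (R'_mat S l ** Z_mat S k))
     + (\<Sum>l\<in>copilot S k - {k}.
          (pdata S l * phat S k * phat S l * (tau_p S)\<^sup>2) *\<^sub>R outer (z_vec S k l) (z_vec S k l))
     - pdata S k *\<^sub>R (L_mat S k ** L_mat S k)
     + sigma2 S *\<^sub>R Z_mat S k"

text \<open>The quotients below are formed in the complex numbers because traces and Hermitian forms of
  complex matrices are complex; that their values are real is part of what is to be shown.\<close>

definition trace_den ::
  "('m::finite, 'k::finite, 't::finite, 'w) uplink \<Rightarrow> complex^'m \<Rightarrow> 'k \<Rightarrow> complex" where
  "trace_den S a k = (let A = diag_mat a in
     (\<Sum>l\<in>UNIV. complex_of_real (pdata S l) * trace (ctransp A ** R'_mat S l ** Z_mat S k ** A))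
     + (\<Sum>l\<in>copilot S k - {k}.
          complex_of_real (pdata S l * phat S k * phat S l * (tau_p S)\<^sup>2
            * (cmod (trace (A ** R_mat S l ** Lambda_mat S k ** R_mat S k)))\<^sup>2))
     + trace (ctransp A
         ** (sigma2 S *\<^sub>R Z_mat S k - pdata S k *\<^sub>R (L_mat S k ** L_mat S k)) ** A))"

definition sinr_mmse ::
  "('m::finite, 'k::finite, 't::finite, 'w) uplink \<Rightarrow> complex^'m \<Rightarrow> 'k \<Rightarrow> complex" where
  "sinr_mmse S a k =
     complex_of_real (pdata S k * (cmod (trace (diag_mat a ** Z_mat S k)))\<^sup>2) / trace_den S a k"

definition sinr_rayleigh ::
  "('m::finite, 'k::finite, 't::finite, 'w) uplink \<Rightarrow> complex^'m \<Rightarrow> 'k \<Rightarrow> complex" where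
  "sinr_rayleigh S a k =
     complex_of_real (pdata S k) * herm_inner a (outer (b_vec S k) (b_vec S k) *v a)
     / herm_inner a (Gamma_mat S k *v a)"

definition lsfd_opt ::
  "('m::finite, 'k::finite, 't::finite, 'w) uplink \<Rightarrow> 'k \<Rightarrow> complex^'m" where
  "lsfd_opt S k = matrix_inv (Gamma_mat S k) *v b_vec S k"

end

theory Submission
  imports Defs
begin

text \<open>
  Write \<open>v\<^sub>m = H\<^sub>k e\<^sub>k + d g\<^sub>l + u\<close> for the estimate at access point \<open>m\<close>, where \<open>e\<^sub>k\<close> is the phase factor
  of user \<open>k\<close>, \<open>g\<^sub>l\<close> is the scattered channel of the user \<open>l\<close> under consideration, and \<open>u\<close> collects
  the remaining pilot contamination and the noise. The four variables \<open>e\<^sub>k\<close>, \<open>e\<^sub>l\<close>, \<open>g\<^sub>l\<close>, \<open>u\<close> (three if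
  \<open>l = k\<close>) are independent and centred, so the second moment of \<open>cnj v\<^sub>m * h\<^sub>m\<^sub>l\<close> splits off one factor at
  a time, down to the second and fourth moments of a Gaussian. The products for different access
  points are independent, hence only their variances and the square of the sum of their means
  contribute. The resulting denominator is the form of \<open>\<Gamma>\<^sub>k\<close>, which is positive definite because
  \<open>L\<^sub>k\<^sup>2 \<le> R'\<^sub>k Z\<^sub>k\<close> and \<open>\<sigma>\<^sup>2 Z\<^sub>k\<close> is positive; optimality of \<open>\<Gamma>\<^sub>k\<^sup>-\<^sup>1 b\<^sub>k\<close> is then the
  Cauchy-Schwarz inequality for this form.
\<close>

section \<open>Centred independent variables\<close>

definition all_moments :: "'w measure \<Rightarrow> ('w \<Rightarrow> complex) \<Rightarrow> bool" where
  "all_moments M f \<longleftrightarrow> f \<in> borel_measurable M \<and> (\<forall>n. integrable M (\<lambda>\<omega>. cmod (f \<omega>) ^ n))"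

lemma borel_measurable_cnj [measurable (raw)]:
  "f \<in> borel_measurable M \<Longrightarrow> (\<lambda>\<omega>. cnj (f \<omega>)) \<in> borel_measurable M"
  by (rule measurable_compose[of f _ borel])
     (auto intro: borel_measurable_continuous_onI continuous_intros)

lemma all_moments_integrable:
  assumes "all_moments M f"
  shows "integrable M f"
proof -
  have "integrable M (\<lambda>\<omega>. cmod (f \<omega>) ^ 1)" "f \<in> borel_measurable M"
    using assms unfolding all_moments_def by blast+
  then show ?thesis by (simp add: integrable_norm_iff)
qed

lemma all_moments_integrable_square:
  "all_moments M f \<Longrightarrow> integrable M (\<lambda>\<omega>. (cmod (f \<omega>))\<^sup>2)"
  unfolding all_moments_def by blast

text \<open>Closure under products holds without independence: the moment of order n of a product is
  dominated by the moments of order 2n of the factors. Integrability of every polynomial in the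
  sources thus becomes a matter of introduction rules.\<close>

lemma all_moments_mult:
  assumes f: "all_moments M f" and g: "all_moments M g"
  shows "all_moments M (\<lambda>\<omega>. f \<omega> * g \<omega>)"
  unfolding all_moments_def
proof (intro conjI allI)
  have [measurable]: "f \<in> borel_measurable M" "g \<in> borel_measurable M"
    using f g unfolding all_moments_def by blast+
  show "(\<lambda>\<omega>. f \<omega> * g \<omega>) \<in> borel_measurable M" by measurable
  fix n
  have I: "integrable M (\<lambda>\<omega>. cmod (f \<omega>) ^ (2*n) + cmod (g \<omega>) ^ (2*n))"
    using f g unfolding all_moments_def by (intro Bochner_Integration.integrable_add) blast+
  show "integrable M (\<lambda>\<omega>. cmod (f \<omega> * g \<omega>) ^ n)"
  proof (rule Bochner_Integration.integrable_bound[OF I], measurable, intro AE_I2)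
    fix \<omega>
    have "2 * (cmod (f \<omega>) ^ n * cmod (g \<omega>) ^ n)
        \<le> (cmod (f \<omega>) ^ n)\<^sup>2 + (cmod (g \<omega>) ^ n)\<^sup>2"
      using sum_squares_bound[of "cmod (f \<omega>) ^ n" "cmod (g \<omega>) ^ n"] by (simp add: mult.assoc)
    moreover have "0 \<le> cmod (f \<omega>) ^ n * cmod (g \<omega>) ^ n" by simp
    ultimately have "cmod (f \<omega>) ^ n * cmod (g \<omega>) ^ n
        \<le> (cmod (f \<omega>) ^ n)\<^sup>2 + (cmod (g \<omega>) ^ n)\<^sup>2"
      by linarith
    then show "norm (cmod (f \<omega> * g \<omega>) ^ n)
        \<le> norm (cmod (f \<omega>) ^ (2*n) + cmod (g \<omega>) ^ (2*n))"
      by (simp add: norm_mult power_mult_distrib power_mult mult.commute[of 2])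
  qed
qed

lemma all_moments_add:
  assumes f: "all_moments M f" and g: "all_moments M g"
  shows "all_moments M (\<lambda>\<omega>. f \<omega> + g \<omega>)"
  unfolding all_moments_def
proof (intro conjI allI)
  have [measurable]: "f \<in> borel_measurable M" "g \<in> borel_measurable M"
    using f g unfolding all_moments_def by blast+
  show "(\<lambda>\<omega>. f \<omega> + g \<omega>) \<in> borel_measurable M" by measurable
  fix n
  have I: "integrable M (\<lambda>\<omega>. 2 ^ n * (cmod (f \<omega>) ^ n + cmod (g \<omega>) ^ n))"
    using f g unfolding all_moments_def
    by (intro integrable_mult_right Bochner_Integration.integrable_add) blast+
  show "integrable M (\<lambda>\<omega>. cmod (f \<omega> + g \<omega>) ^ n)"
  proof (rule Bochner_Integration.integrable_bound[OF I], measurable, intro AE_I2)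
    fix \<omega>
    \<comment> \<open>With m the larger modulus, the sum is at most 2 * m, and m ^ n is one of the
      two n-th powers, hence at most their sum.\<close>
    define m where "m = max (cmod (f \<omega>)) (cmod (g \<omega>))"
    have "cmod (f \<omega> + g \<omega>) \<le> 2 * m"
      using norm_triangle_ineq[of "f \<omega>" "g \<omega>"] unfolding m_def by linarith
    then have "cmod (f \<omega> + g \<omega>) ^ n \<le> (2 * m) ^ n" by (intro power_mono) auto
    also have "\<dots> = 2 ^ n * m ^ n" by (simp add: power_mult_distrib)
    also have "m ^ n \<le> cmod (f \<omega>) ^ n + cmod (g \<omega>) ^ n"
      unfolding m_def by (simp add: max_def)
    finally show "norm (cmod (f \<omega> + g \<omega>) ^ n)
        \<le> norm (2 ^ n * (cmod (f \<omega>) ^ n + cmod (g \<omega>) ^ n))"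
      by simp
  qed
qed

lemma all_moments_cnj: "all_moments M f \<Longrightarrow> all_moments M (\<lambda>\<omega>. cnj (f \<omega>))"
  unfolding all_moments_def by auto

lemma all_moments_of_real_cmod:
  "all_moments M f \<Longrightarrow> all_moments M (\<lambda>\<omega>. complex_of_real (cmod (f \<omega>)))"
  unfolding all_moments_def by auto

context prob_space
begin

lemma all_moments_bounded:
  assumes [measurable]: "f \<in> borel_measurable M" and "\<And>\<omega>. cmod (f \<omega>) \<le> B"
  shows "all_moments M f"
  unfolding all_moments_def
proof (intro conjI allI)
  fix n
  show "integrable M (\<lambda>\<omega>. cmod (f \<omega>) ^ n)"
    by (rule integrable_const_bound[where B = "B ^ n"])
       (auto simp: norm_power intro!: power_mono assms)
qed simp

lemma all_moments_const: "all_moments M (\<lambda>\<omega>. c)"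
  by (rule all_moments_bounded[where B = "cmod c"]) auto

lemma all_moments_sum:
  "(\<And>i. i \<in> A \<Longrightarrow> all_moments M (f i)) \<Longrightarrow> all_moments M (\<lambda>\<omega>. \<Sum>i\<in>A. f i \<omega>)"
  by (induction A rule: infinite_finite_induct)
     (auto intro!: all_moments_const all_moments_add)

lemma all_moments_diff:
  assumes "all_moments M f" "all_moments M g"
  shows "all_moments M (\<lambda>\<omega>. f \<omega> - g \<omega>)"
  using all_moments_add[OF assms(1) all_moments_mult[OF all_moments_const[of "-1"] assms(2)]]
  by simp

lemmas all_moments_intros =
  all_moments_mult all_moments_add all_moments_cnj all_moments_const all_moments_sum
  all_moments_diff all_moments_of_real_cmod

text \<open>The sigma-algebra on the sample space generated by the \<open>X i\<close> with
  \<open>i\<close> in \<open>J\<close>. Measurability with respect to it expresses that a variable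
  is a function of these sources only, so that independence can be read off from index sets.\<close>

definition gen_by :: "('i \<Rightarrow> 'a \<Rightarrow> complex) \<Rightarrow> 'i set \<Rightarrow> 'a measure" where
  "gen_by X J = vimage_algebra (space M) (\<lambda>\<omega>. \<lambda>i\<in>J. X i \<omega>) (PiM J (\<lambda>_. borel))"

lemma measurable_gen_by_source:
  assumes "i \<in> J"
  shows "X i \<in> borel_measurable (gen_by X J)"
proof -
  have "(\<lambda>\<omega>. \<lambda>i\<in>J. X i \<omega>) \<in> measurable (gen_by X J) (PiM J (\<lambda>_. borel))"
    unfolding gen_by_def by (rule measurable_vimage_algebra1) (auto simp: space_PiM)
  from measurable_compose[OF this measurable_component_singleton[OF assms]]
  show ?thesis using assms by simp
qed

lemma measurable_gen_by_mono:
  assumes f: "f \<in> measurable (gen_by X J) N" and sub: "J \<subseteq> J'"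
  shows "f \<in> measurable (gen_by X J') N"
proof -
  have "(\<lambda>\<omega>. \<lambda>i\<in>J. X i \<omega>) \<in> measurable (gen_by X J') (PiM J (\<lambda>_. borel))"
    using sub by (intro measurable_restrict measurable_gen_by_source) auto
  \<comment> \<open>The identity map is measurable from the finer sigma-algebra to the coarser one;
    composing with it enlarges the index set.\<close>
  then have "(\<lambda>\<omega>. \<omega>) \<in> measurable (gen_by X J') (gen_by X J)"
    unfolding gen_by_def[of X J] by (intro measurable_vimage_algebra2) (auto simp: gen_by_def)
  from measurable_compose[OF this f] show ?thesis .
qed

text \<open>Functions of disjoint groups of independent sources are independent: the two tuples of
  sources are independent, and the sigma-algebras generated by \<open>f\<close> and \<open>g\<close>
  lie inside those generated by the tuples.\<close>

lemma indep_var_gen_by: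
  assumes ind: "indep_vars (\<lambda>_. borel) X UNIV" and disj: "J \<inter> J' = {}"
    and f: "f \<in> measurable (gen_by X J) N" and g: "g \<in> measurable (gen_by X J') N'"
  shows "indep_var N f N' g"
proof -
  have r: "(\<lambda>\<omega>. \<lambda>i\<in>K. X i \<omega>) \<in> measurable M (PiM K (\<lambda>_. borel))" for K
    using ind by (intro measurable_restrict) (auto simp: indep_vars_def)
  \<comment> \<open>Carries measurability with respect to the generated sigma-algebra over to the
    whole space.\<close>
  have id: "(\<lambda>\<omega>. \<omega>) \<in> measurable M (gen_by X K)" for K
    unfolding gen_by_def by (rule measurable_vimage_algebra2) (auto intro: r)
  have "indep_var (PiM J (\<lambda>_. borel)) (\<lambda>\<omega>. \<lambda>i\<in>J. X i \<omega>)
          (PiM J' (\<lambda>_. borel)) (\<lambda>\<omega>. \<lambda>i\<in>J'. X i \<omega>)"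
    using ind disj by (intro indep_var_restrict) auto
  then have "indep_set (sets (gen_by X J)) (sets (gen_by X J'))"
    by (simp add: indep_var_eq gen_by_def sets_vimage_algebra)
  moreover have "sigma_sets (space M) {h -` A \<inter> space M |A. A \<in> sets L} \<subseteq> sets (gen_by X K)"
    if "h \<in> measurable (gen_by X K) L" for h K and L :: "'z measure"
  proof -
    have "space (gen_by X K) = space M" by (simp add: gen_by_def)
    then have "{h -` A \<inter> space M |A. A \<in> sets L} \<subseteq> sets (gen_by X K)"
      using measurable_sets[OF that] by auto
    from sets.sigma_sets_subset[OF this] show ?thesis
      using \<open>space (gen_by X K) = space M\<close> by simp
  qed
  note this[OF f] this[OF g]
  ultimately have "indep_set (sigma_sets (space M) {f -` A \<inter> space M |A. A \<in> sets N})
      (sigma_sets (space M) {g -` A \<inter> space M |A. A \<in> sets N'})"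
    unfolding indep_set_def by (elim indep_sets_mono_sets) (auto split: bool.split)
  then show ?thesis
    unfolding indep_var_eq
    using measurable_compose[OF id f] measurable_compose[OF id g] by auto
qed

section \<open>Factorisation of moments over disjoint groups of sources\<close>

lemma expectation_mult_gen_by:
  fixes f g :: "'a \<Rightarrow> complex"
  assumes "indep_vars (\<lambda>_. borel) X UNIV" "J \<inter> J' = {}"
    and "f \<in> borel_measurable (gen_by X J)" "g \<in> borel_measurable (gen_by X J')"
    and "all_moments M f" "all_moments M g"
  shows "expectation (\<lambda>\<omega>. f \<omega> * g \<omega>) = expectation f * expectation g"
  using indep_var_gen_by[OF assms(1-4)] assms(5,6)
  by (intro indep_var_lebesgue_integral) (auto intro: all_moments_integrable)

lemma expectation_square_mult_gen_by:
  fixes f g :: "'a \<Rightarrow> complex"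
  assumes "indep_vars (\<lambda>_. borel) X UNIV" "J \<inter> J' = {}"
    and [measurable]: "f \<in> borel_measurable (gen_by X J)" "g \<in> borel_measurable (gen_by X J')"
    and "all_moments M f" "all_moments M g"
  shows "expectation (\<lambda>\<omega>. (cmod (f \<omega> * g \<omega>))\<^sup>2)
       = expectation (\<lambda>\<omega>. (cmod (f \<omega>))\<^sup>2) * expectation (\<lambda>\<omega>. (cmod (g \<omega>))\<^sup>2)"
proof -
  have "indep_var borel (\<lambda>\<omega>. (cmod (f \<omega>))\<^sup>2) borel (\<lambda>\<omega>. (cmod (g \<omega>))\<^sup>2)"
    by (rule indep_var_gen_by[OF assms(1,2)]) measurable
  then show ?thesis
    using assms(5,6) unfolding norm_mult power_mult_distrib
    by (intro indep_var_lebesgue_integral) (auto intro: all_moments_integrable_square)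
qed

text \<open>The cross term vanishes because \<open>u\<close> is centred.\<close>

lemma second_moment_add_centred:
  assumes X: "indep_vars (\<lambda>_. borel) X UNIV" "J \<inter> J' = {}"
    and [measurable]: "u \<in> borel_measurable (gen_by X J)"
      "p \<in> borel_measurable (gen_by X J')" "q \<in> borel_measurable (gen_by X J')"
    and m: "all_moments M u" "all_moments M p" "all_moments M q"
    and u: "expectation u = 0"
  shows "expectation (\<lambda>\<omega>. (cmod (p \<omega> + u \<omega> * q \<omega>))\<^sup>2)
       = expectation (\<lambda>\<omega>. (cmod (p \<omega>))\<^sup>2)
         + expectation (\<lambda>\<omega>. (cmod (u \<omega>))\<^sup>2) * expectation (\<lambda>\<omega>. (cmod (q \<omega>))\<^sup>2)"
proof -
  \<comment> \<open>The cross term is \<open>2 * Re (u * r)\<close>, and \<open>r\<close> depends on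
    the sources in \<open>J'\<close> only, so its expectation contains the factor
    \<open>expectation u\<close>.\<close>
  define r where "r = (\<lambda>\<omega>. cnj (p \<omega>) * q \<omega>)"
  have r: "all_moments M r" unfolding r_def by (intro all_moments_intros m)
  have [measurable]: "r \<in> borel_measurable (gen_by X J')" unfolding r_def by measurable
  have "expectation (\<lambda>\<omega>. Re (u \<omega> * r \<omega>)) = Re (expectation (\<lambda>\<omega>. u \<omega> * r \<omega>))"
    by (intro integral_Re all_moments_integrable all_moments_intros m r)
  also have "expectation (\<lambda>\<omega>. u \<omega> * r \<omega>) = 0"
    using u by (subst expectation_mult_gen_by[OF X]) (auto intro: m r)
  finally have cross: "expectation (\<lambda>\<omega>. Re (u \<omega> * r \<omega>)) = 0" by simp
  have "(cmod (p \<omega> + u \<omega> * q \<omega>))\<^sup>2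
      = (cmod (p \<omega>))\<^sup>2 + (cmod (u \<omega> * q \<omega>))\<^sup>2 + 2 * Re (u \<omega> * r \<omega>)" for \<omega>
    unfolding r_def cmod_power2 by (simp add: power2_eq_square algebra_simps)
  moreover have "integrable M (\<lambda>\<omega>. (cmod (p \<omega>))\<^sup>2)" "integrable M (\<lambda>\<omega>. (cmod (u \<omega> * q \<omega>))\<^sup>2)"
    "integrable M (\<lambda>\<omega>. Re (u \<omega> * r \<omega>))"
    by (intro all_moments_integrable_square integrable_Re all_moments_integrable
        all_moments_intros m r)+
  ultimately show ?thesis
    using expectation_square_mult_gen_by[OF X _ _ m(1,3)] cross
    by (simp del: times_complex.sel)
qed

text \<open>One summand is split off per induction step: \<open>Y i\<close> is the centred variable,
  the constant \<open>c i\<close> is its cofactor, and the remaining sum depends on the other groups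
  of sources.\<close>

lemma second_moment_sum_centred:
  fixes c :: "'j \<Rightarrow> complex"
  assumes X: "indep_vars (\<lambda>_. borel) X UNIV" "disjoint_family_on K A" and "finite A"
    and Y: "\<And>i. i \<in> A \<Longrightarrow> Y i \<in> borel_measurable (gen_by X (K i))"
    and m: "\<And>i. i \<in> A \<Longrightarrow> all_moments M (Y i)"
    and z: "\<And>i. i \<in> A \<Longrightarrow> expectation (Y i) = 0"
  shows "expectation (\<lambda>\<omega>. (cmod (\<Sum>i\<in>A. c i * Y i \<omega>))\<^sup>2)
       = (\<Sum>i\<in>A. (cmod (c i))\<^sup>2 * expectation (\<lambda>\<omega>. (cmod (Y i \<omega>))\<^sup>2))"
  using \<open>finite A\<close> X(2) Y m z
proof (induction A rule: finite_induct)
  case (insert i A)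
  have "(\<lambda>\<omega>. \<Sum>i\<in>A. c i * Y i \<omega>) \<in> borel_measurable (gen_by X (\<Union>j\<in>A. K j))"
    using insert by (intro borel_measurable_sum borel_measurable_times borel_measurable_const)
      (auto intro!: measurable_gen_by_mono[where J = "K _" and J' = "\<Union>j\<in>A. K j"])
  moreover have "K i \<inter> (\<Union>j\<in>A. K j) = {}"
    using insert.prems(1) insert.hyps by (auto simp: disjoint_family_on_def)
  moreover have "all_moments M (\<lambda>\<omega>. \<Sum>i\<in>A. c i * Y i \<omega>)"
    using insert by (intro all_moments_intros) auto
  ultimately have "expectation (\<lambda>\<omega>. (cmod ((\<Sum>i\<in>A. c i * Y i \<omega>) + Y i \<omega> * c i))\<^sup>2)
      = expectation (\<lambda>\<omega>. (cmod (\<Sum>i\<in>A. c i * Y i \<omega>))\<^sup>2)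
        + expectation (\<lambda>\<omega>. (cmod (Y i \<omega>))\<^sup>2) * expectation (\<lambda>\<omega>. (cmod (c i))\<^sup>2)"
    using insert.prems
    by (intro second_moment_add_centred[OF X(1), of "K i" "\<Union>j\<in>A. K j"])
       (auto intro: all_moments_const)
  moreover have "expectation (\<lambda>\<omega>. (cmod (\<Sum>i\<in>A. c i * Y i \<omega>))\<^sup>2)
       = (\<Sum>i\<in>A. (cmod (c i))\<^sup>2 * expectation (\<lambda>\<omega>. (cmod (Y i \<omega>))\<^sup>2))"
    using insert.prems by (intro insert.IH) (auto intro: disjoint_family_on_mono)
  ultimately show ?case
    using insert.hyps by (simp add: add.commute mult.commute prob_space)
qed simp

section \<open>Second moments of variables with nonzero mean\<close>

lemma second_moment_eq_centred:
  assumes "all_moments M Y"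
  shows "expectation (\<lambda>\<omega>. (cmod (Y \<omega>))\<^sup>2)
       = expectation (\<lambda>\<omega>. (cmod (Y \<omega> - expectation Y))\<^sup>2) + (cmod (expectation Y))\<^sup>2"
proof -
  define \<mu> where "\<mu> = expectation Y"
  have e: "(cmod (Y \<omega> - \<mu>))\<^sup>2 = (cmod (Y \<omega>))\<^sup>2 - 2 * Re (Y \<omega> * cnj \<mu>) + (cmod \<mu>)\<^sup>2" for \<omega>
    unfolding cmod_power2 by (simp add: power2_eq_square algebra_simps)
  have i: "integrable M (\<lambda>\<omega>. (cmod (Y \<omega>))\<^sup>2)" "integrable M (\<lambda>\<omega>. Y \<omega> * cnj \<mu>)"
    by (intro all_moments_integrable_square all_moments_integrable all_moments_intros assms)+
  have "expectation (\<lambda>\<omega>. Re (Y \<omega> * cnj \<mu>)) = Re (expectation (\<lambda>\<omega>. Y \<omega> * cnj \<mu>))"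
    by (rule integral_Re[OF i(2)])
  also have "\<dots> = (cmod \<mu>)\<^sup>2"
    using all_moments_integrable[OF assms]
    by (simp add: \<mu>_def complex_mult_cnj cmod_power2)
  finally show ?thesis
    using i integrable_Re[OF i(2)] unfolding \<mu>_def[symmetric] e
    by (simp add: prob_space del: complex_cnj_complex_of_real Re_complex_of_real times_complex.sel)
qed

text \<open>Obtained by centring every summand. Variances add with the weights
  \<open>(cmod (c i))\<^sup>2\<close>, which will give the incoherent interference; the means add
  before squaring, which will give the coherent interference.\<close>

lemma second_moment_sum:
  fixes c :: "'j \<Rightarrow> complex"
  assumes X: "indep_vars (\<lambda>_. borel) X UNIV" "disjoint_family_on K A" and A: "finite A"
    and Y: "\<And>i. i \<in> A \<Longrightarrow> Y i \<in> borel_measurable (gen_by X (K i))"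
    and m: "\<And>i. i \<in> A \<Longrightarrow> all_moments M (Y i)"
  shows "expectation (\<lambda>\<omega>. (cmod (\<Sum>i\<in>A. c i * Y i \<omega>))\<^sup>2)
       = (\<Sum>i\<in>A. (cmod (c i))\<^sup>2 *
            (expectation (\<lambda>\<omega>. (cmod (Y i \<omega>))\<^sup>2) - (cmod (expectation (Y i)))\<^sup>2))
         + (cmod (\<Sum>i\<in>A. c i * expectation (Y i)))\<^sup>2"
proof -
  let ?S = "\<lambda>\<omega>. \<Sum>i\<in>A. c i * Y i \<omega>"
  have E: "expectation ?S = (\<Sum>i\<in>A. c i * expectation (Y i))"
    using all_moments_integrable[OF m] by simp
  have "expectation (\<lambda>\<omega>. (cmod (?S \<omega> - expectation ?S))\<^sup>2)
      = expectation (\<lambda>\<omega>. (cmod (\<Sum>i\<in>A. c i * (Y i \<omega> - expectation (Y i))))\<^sup>2)"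
    unfolding E by (simp add: sum_subtractf right_diff_distrib)
  also have "\<dots> = (\<Sum>i\<in>A. (cmod (c i))\<^sup>2 *
      expectation (\<lambda>\<omega>. (cmod (Y i \<omega> - expectation (Y i)))\<^sup>2))"
    using all_moments_integrable[OF m] Y m
    by (intro second_moment_sum_centred[OF X A])
       (auto intro!: all_moments_intros simp: prob_space)
  also have "\<dots> = (\<Sum>i\<in>A. (cmod (c i))\<^sup>2 *
      (expectation (\<lambda>\<omega>. (cmod (Y i \<omega>))\<^sup>2) - (cmod (expectation (Y i)))\<^sup>2))"
    using second_moment_eq_centred[OF m] by (intro sum.cong) auto
  finally show ?thesis
    using second_moment_eq_centred[of ?S] m E by (simp add: all_moments_intros)
qed

end

section \<open>Gaussian and phase moments\<close>

lemma normal_power: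
  assumes D: "distributed M lborel Y (normal_density 0 s)" and s: "0 < s"
  shows "integrable M (\<lambda>\<omega>. \<bar>Y \<omega>\<bar> ^ n)" and "integrable M (\<lambda>\<omega>. Y \<omega> ^ n)"
    and "odd n \<Longrightarrow> (\<integral>\<omega>. Y \<omega> ^ n \<partial>M) = 0"
    and "(\<integral>\<omega>. (Y \<omega>)\<^sup>2 \<partial>M) = s\<^sup>2"
    and "(\<integral>\<omega>. Y \<omega> ^ 4 \<partial>M) = 3 * s ^ 4"
proof -
  show "integrable M (\<lambda>\<omega>. \<bar>Y \<omega>\<bar> ^ n)"
    using distributed_integrable[OF D, of "\<lambda>x. \<bar>x\<bar> ^ n"] integrable_normal_moment_abs[OF s, of 0 n]
    by simp
  show "integrable M (\<lambda>\<omega>. Y \<omega> ^ n)"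
    using distributed_integrable[OF D, of "\<lambda>x. x ^ n"] integrable_normal_moment[OF s, of 0 n]
    by simp
  show "(\<integral>\<omega>. Y \<omega> ^ n \<partial>M) = 0" if "odd n"
    using distributed_integral[OF D, of "\<lambda>x. x ^ n"] integral_normal_moment_odd[OF s, of 0] that
    by (auto elim!: oddE)
  show "(\<integral>\<omega>. (Y \<omega>)\<^sup>2 \<partial>M) = s\<^sup>2"
    using distributed_integral[OF D, of "\<lambda>x. x\<^sup>2"] integral_normal_moment_even[OF s, of 0 1]
    by simp
  \<comment> \<open>The even moment of order 2k with k = 2: the factor is 4! / (2^2 * 2!) =
    3.\<close>
  show "(\<integral>\<omega>. Y \<omega> ^ 4 \<partial>M) = 3 * s ^ 4"
    using distributed_integral[OF D, of "\<lambda>x. x ^ 4"] integral_normal_moment_even[OF s, of 0 2] s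
    by (simp add: fact_numeral field_simps power_divide)
qed

lemma borel_measurable_cis: "cis \<in> borel_measurable borel"
  by (intro borel_measurable_continuous_onI continuous_intros)

context prob_space
begin

text \<open>Every claim is about a polynomial in the real and imaginary parts, whose mixed moments
  factor by independence. That the square has mean zero reflects the equal variances of the two
  parts.\<close>

lemma circ_gaussian_moments:
  assumes G: "circ_gaussian M X v" and v: "0 < v"
  shows "all_moments M X" and "expectation X = 0" and "expectation (\<lambda>\<omega>. (X \<omega>)\<^sup>2) = 0"
    and "expectation (\<lambda>\<omega>. (cmod (X \<omega>))\<^sup>2) = v"
    and "expectation (\<lambda>\<omega>. (cmod (X \<omega>)) ^ 4) = 2 * v\<^sup>2"
    and "expectation (\<lambda>\<omega>. of_real ((cmod (X \<omega>))\<^sup>2) * X \<omega>) = 0"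
proof -
  define s where "s = sqrt (v / 2)"
  have s: "0 < s" and s2: "s\<^sup>2 = v / 2" and s4: "s ^ 4 = v\<^sup>2 / 4"
    using v power_mult[of s 2 2] by (auto simp: s_def power_divide)
  define x where "x = (\<lambda>\<omega>. Re (X \<omega>))"
  define y where "y = (\<lambda>\<omega>. Im (X \<omega>))"
  have ind: "indep_var borel x borel y"
    and dx: "distributed M lborel x (normal_density 0 s)"
    and dy: "distributed M lborel y (normal_density 0 s)"
    using G unfolding circ_gaussian_def x_def y_def s_def by auto
  note nx = normal_power[OF dx s] and ny = normal_power[OF dy s]
  have [measurable]: "x \<in> borel_measurable M" "y \<in> borel_measurable M"
    using distributed_measurable[OF dx] distributed_measurable[OF dy] by simp_all
  have Xxy: "X = (\<lambda>\<omega>. of_real (x \<omega>) + \<i> * of_real (y \<omega>))"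
    by (auto simp: x_def y_def complex_eq_iff)
  have mx: "all_moments M (\<lambda>\<omega>. of_real (x \<omega>))" and my: "all_moments M (\<lambda>\<omega>. of_real (y \<omega>))"
    using nx(1) ny(1) by (auto simp: all_moments_def)
  show mX: "all_moments M X" unfolding Xxy by (intro all_moments_intros mx my)
  have prod: "expectation (\<lambda>\<omega>. x \<omega> ^ a * y \<omega> ^ b)
        = expectation (\<lambda>\<omega>. x \<omega> ^ a) * expectation (\<lambda>\<omega>. y \<omega> ^ b)"
    and iprod: "integrable M (\<lambda>\<omega>. x \<omega> ^ a * y \<omega> ^ b)" for a b
  proof -
    have "indep_var borel ((\<lambda>t. t ^ a) \<circ> x) borel ((\<lambda>t. t ^ b) \<circ> y)"
      by (rule indep_var_compose[OF ind]) measurable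
    then have i: "indep_var borel (\<lambda>\<omega>. x \<omega> ^ a) borel (\<lambda>\<omega>. y \<omega> ^ b)" by (simp add: comp_def)
    show "expectation (\<lambda>\<omega>. x \<omega> ^ a * y \<omega> ^ b)
        = expectation (\<lambda>\<omega>. x \<omega> ^ a) * expectation (\<lambda>\<omega>. y \<omega> ^ b)"
      by (rule indep_var_lebesgue_integral[OF i nx(2) ny(2)])
    show "integrable M (\<lambda>\<omega>. x \<omega> ^ a * y \<omega> ^ b)"
      by (rule indep_var_integrable[OF i nx(2) ny(2)])
  qed
  note p = prod[of 1 1] prod[of 1 2] prod[of 2 1] prod[of 2 2]
  note ip = iprod[of 1 1] iprod[of 1 2] iprod[of 2 1] iprod[of 2 2]
  have odd: "expectation x = 0" "expectation y = 0"
    "expectation (\<lambda>\<omega>. x \<omega> ^ 3) = 0" "expectation (\<lambda>\<omega>. y \<omega> ^ 3) = 0"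
    using nx(3)[of 1] ny(3)[of 1] nx(3)[of 3] ny(3)[of 3] by simp_all
  show "expectation (\<lambda>\<omega>. (cmod (X \<omega>))\<^sup>2) = v"
    using nx(2)[of 2] ny(2)[of 2] nx(4) ny(4) s2
    by (simp add: cmod_power2 flip: x_def y_def fun_cong[OF x_def] fun_cong[OF y_def])
  have "cmod (X \<omega>) ^ 4 = x \<omega> ^ 4 + 2 * (x \<omega> ^ 2 * y \<omega> ^ 2) + y \<omega> ^ 4" for \<omega>
  proof -
    have "cmod (X \<omega>) ^ 4 = ((cmod (X \<omega>))\<^sup>2)\<^sup>2" by simp
    then show ?thesis unfolding cmod_power2 x_def y_def by algebra
  qed
  \<comment> \<open>The sum is 8 * s^4, and s^2 = v / 2 turns it into 2 * v^2.\<close>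
  then have "expectation (\<lambda>\<omega>. (cmod (X \<omega>)) ^ 4) = 3 * s ^ 4 + 2 * (s\<^sup>2 * s\<^sup>2) + 3 * s ^ 4"
    using nx(2)[of 4] ny(2)[of 4] nx(4,5) ny(4,5) ip p by simp
  then show "expectation (\<lambda>\<omega>. (cmod (X \<omega>)) ^ 4) = 2 * v\<^sup>2"
    unfolding s2 s4 by (simp add: power2_eq_square field_simps)
  show "expectation X = 0"
    using integral_Re[OF all_moments_integrable[OF mX]] integral_Im[OF all_moments_integrable[OF mX]]
      odd by (simp add: complex_eq_iff x_def y_def)
  have "integrable M (\<lambda>\<omega>. (X \<omega>)\<^sup>2)"
    using all_moments_integrable[OF all_moments_mult[OF mX mX]] by (simp add: power2_eq_square)
  note i = integral_Re[OF this] integral_Im[OF this]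
  have "Re ((X \<omega>)\<^sup>2) = x \<omega> ^ 2 - y \<omega> ^ 2" "Im ((X \<omega>)\<^sup>2) = 2 * (x \<omega> ^ 1 * y \<omega> ^ 1)" for \<omega>
    by (simp_all add: x_def y_def power2_eq_square)
  then show "expectation (\<lambda>\<omega>. (X \<omega>)\<^sup>2) = 0"
    using i nx(2)[of 2] ny(2)[of 2] nx(4) ny(4) ip p odd by (simp add: complex_eq_iff)
  have "all_moments M (\<lambda>\<omega>. of_real (cmod (X \<omega>)) * (of_real (cmod (X \<omega>)) * X \<omega>))"
    by (intro all_moments_intros mX)
  from all_moments_integrable[OF this]
  have "integrable M (\<lambda>\<omega>. of_real ((cmod (X \<omega>))\<^sup>2) * X \<omega>)"
    by (simp add: power2_eq_square mult.assoc)
  note i = integral_Re[OF this] integral_Im[OF this]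
  \<comment> \<open>Every monomial on the right has an odd exponent in \<open>x\<close> or in
    \<open>y\<close>, so its expectation is zero.\<close>
  have "Re (of_real ((cmod (X \<omega>))\<^sup>2) * X \<omega>) = x \<omega> ^ 3 + x \<omega> ^ 1 * y \<omega> ^ 2"
    "Im (of_real ((cmod (X \<omega>))\<^sup>2) * X \<omega>) = x \<omega> ^ 2 * y \<omega> ^ 1 + y \<omega> ^ 3" for \<omega>
    unfolding x_def y_def cmod_power2
    by (simp_all add: power2_eq_square power3_eq_cube algebra_simps)
  then show "expectation (\<lambda>\<omega>. of_real ((cmod (X \<omega>))\<^sup>2) * X \<omega>) = 0"
    using i nx(2)[of 3] ny(2)[of 3] ip p odd by (simp add: complex_eq_iff)
qed

text \<open>The modulus is bounded by 1, which gives all moments; the mean vanishes because cosine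
  and sine integrate to zero over a full period.\<close>

lemma cis_uniform:
  assumes D: "distributed M lborel \<phi> (\<lambda>x. indicator {-pi..pi} x / measure lborel {-pi..pi})"
  shows "all_moments M (\<lambda>\<omega>. cis (\<phi> \<omega>))" and "expectation (\<lambda>\<omega>. cis (\<phi> \<omega>)) = 0"
proof -
  have [measurable]: "\<phi> \<in> borel_measurable M" using distributed_measurable[OF D] by simp
  show m: "all_moments M (\<lambda>\<omega>. cis (\<phi> \<omega>))"
    by (rule all_moments_bounded[where B = 1]) (auto intro: measurable_compose[OF _ borel_measurable_cis])
  have "expectation (\<lambda>\<omega>. f (\<phi> \<omega>)) = 0"
    if f: "f = cos \<or> f = sin" for f :: "real \<Rightarrow> real"
  proof -
    have [measurable]: "f \<in> borel_measurable borel" using f by auto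
    \<comment> \<open>An antiderivative of \<open>f\<close>, taking equal values at pi and
      -pi.\<close>
    define F where "F = (if f = cos then sin else (\<lambda>x. - cos x) :: real \<Rightarrow> real)"
    have F: "(F has_real_derivative f x) (at x)" for x
      using f by (auto simp: F_def intro!: derivative_eq_intros)
    have cf: "isCont f x" for x using f by auto
    have "expectation (\<lambda>\<omega>. f (\<phi> \<omega>))
        = (\<integral>x. indicator {-pi..pi} x / measure lborel {-pi..pi} * f x \<partial>lborel)"
      by (rule distributed_integral[OF D, symmetric]) auto
    also have "\<dots> = (\<integral>x. f x * indicator {-pi..pi} x \<partial>lborel) / (2 * pi)"
      by (simp add: mult.commute)
    also have "(\<integral>x. f x * indicator {-pi..pi} x \<partial>lborel) = F pi - F (-pi)"
      by (rule integral_FTC_Icc_real) (use F cf in auto)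
    also have "\<dots> = 0" by (simp add: F_def)
    finally show ?thesis by simp
  qed
  then show "expectation (\<lambda>\<omega>. cis (\<phi> \<omega>)) = 0"
    using integral_Re[OF all_moments_integrable[OF m]] integral_Im[OF all_moments_integrable[OF m]]
    by (simp add: complex_eq_iff)
qed

end

section \<open>Moments of a product of estimate and channel\<close>

context prob_space
begin

text \<open>Gives the power of a channel and the power of an estimate. The scattered part and the
  rest are centred and are split off in turn from the line-of-sight term, whose modulus is the
  constant \<open>H\<close>.\<close>

lemma ricean_moments:
  fixes g e u :: "'a \<Rightarrow> complex" and H d \<beta> U :: real
  assumes X: "indep_vars (\<lambda>_. borel) X UNIV"
    and J: "Je \<inter> Jg = {}" "Je \<inter> Ju = {}" "Jg \<inter> Ju = {}"
    and e: "e \<in> borel_measurable (gen_by X Je)" "all_moments M e" "expectation e = 0"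
      "\<And>\<omega>. cmod (e \<omega>) = 1"
    and g: "g \<in> borel_measurable (gen_by X Jg)" "all_moments M g" "expectation g = 0"
      "expectation (\<lambda>\<omega>. (cmod (g \<omega>))\<^sup>2) = \<beta>"
    and u: "u \<in> borel_measurable (gen_by X Ju)" "all_moments M u" "expectation u = 0"
      "expectation (\<lambda>\<omega>. (cmod (u \<omega>))\<^sup>2) = U"
  shows "expectation (\<lambda>\<omega>. (cmod (H * e \<omega> + g \<omega>))\<^sup>2) = H\<^sup>2 + \<beta>"
    and "expectation (\<lambda>\<omega>. (cmod (H * e \<omega> + d * g \<omega> + u \<omega>))\<^sup>2) = H\<^sup>2 + d\<^sup>2 * \<beta> + U"
proof -
  note [measurable] = e(1) g(1) u(1)
  \<comment> \<open>The free constant covers both uses: 1 for the channel and \<open>d\<close> for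
    the scattered part of the estimate.\<close>
  have main: "expectation (\<lambda>\<omega>. (cmod (H * e \<omega> + g \<omega> * c))\<^sup>2) = H\<^sup>2 + (cmod c)\<^sup>2 * \<beta>" for c
    using second_moment_add_centred[OF X(1), of Jg Je g "\<lambda>\<omega>. H * e \<omega>" "\<lambda>_. c"] J e g
    by (simp add: all_moments_intros Int_commute norm_mult power_mult_distrib prob_space mult.commute)
  from main[of 1] show "expectation (\<lambda>\<omega>. (cmod (H * e \<omega> + g \<omega>))\<^sup>2) = H\<^sup>2 + \<beta>" by simp
  have [measurable]: "e \<in> borel_measurable (gen_by X (Je \<union> Jg))"
    "g \<in> borel_measurable (gen_by X (Je \<union> Jg))"
    by (rule measurable_gen_by_mono[OF e(1)] measurable_gen_by_mono[OF g(1)]; blast)+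
  have "expectation (\<lambda>\<omega>. (cmod ((H * e \<omega> + d * g \<omega>) + u \<omega> * 1))\<^sup>2)
      = expectation (\<lambda>\<omega>. (cmod (H * e \<omega> + d * g \<omega>))\<^sup>2)
        + expectation (\<lambda>\<omega>. (cmod (u \<omega>))\<^sup>2) * expectation (\<lambda>\<omega>. (cmod 1)\<^sup>2)"
    using J by (intro second_moment_add_centred[OF X(1), of Ju "Je \<union> Jg"] all_moments_intros e g u)
      (auto, measurable)
  then show "expectation (\<lambda>\<omega>. (cmod (H * e \<omega> + d * g \<omega> + u \<omega>))\<^sup>2) = H\<^sup>2 + d\<^sup>2 * \<beta> + U"
    using main[of d] u(4) by (simp add: prob_space mult.commute)
qed

text \<open>With \<open>t = cnj e * g\<close> the product of the two Ricean terms is \<open>(H + d * cnj t) * (H + t)\<close>,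
  and all terms of its squared modulus other than those in \<open>cmod t\<close> are centred.\<close>

lemma mr_own_channel_moments:
  fixes g e u :: "'a \<Rightarrow> complex" and H d \<beta> U :: real
  assumes X: "indep_vars (\<lambda>_. borel) X UNIV"
    and J: "Je \<inter> Jg = {}" "Je \<inter> Ju = {}" "Jg \<inter> Ju = {}"
    and e: "e \<in> borel_measurable (gen_by X Je)" "all_moments M e" "expectation e = 0"
      "\<And>\<omega>. cmod (e \<omega>) = 1"
    and g: "g \<in> borel_measurable (gen_by X Jg)" "all_moments M g" "expectation g = 0"
      "expectation (\<lambda>\<omega>. (cmod (g \<omega>))\<^sup>2) = \<beta>" "expectation (\<lambda>\<omega>. (cmod (g \<omega>)) ^ 4) = 2 * \<beta>\<^sup>2"
      "expectation (\<lambda>\<omega>. (g \<omega>)\<^sup>2) = 0" "expectation (\<lambda>\<omega>. of_real ((cmod (g \<omega>))\<^sup>2) * g \<omega>) = 0"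
    and u: "u \<in> borel_measurable (gen_by X Ju)" "all_moments M u" "expectation u = 0"
      "expectation (\<lambda>\<omega>. (cmod (u \<omega>))\<^sup>2) = U"
  defines "Y \<equiv> \<lambda>\<omega>. cnj (H * e \<omega> + d * g \<omega> + u \<omega>) * (H * e \<omega> + g \<omega>)"
  shows "expectation Y = of_real (H\<^sup>2 + d * \<beta>)"
    and "expectation (\<lambda>\<omega>. (cmod (Y \<omega>))\<^sup>2)
       = (H\<^sup>2 + d * \<beta>)\<^sup>2 + ((H\<^sup>2 + d\<^sup>2 * \<beta> + U) * (H\<^sup>2 + \<beta>) - H ^ 4)"
proof -
  note [measurable] = e(1) g(1) u(1)
  have meas [measurable]: "e \<in> borel_measurable (gen_by X (Je \<union> Jg))"
    "g \<in> borel_measurable (gen_by X (Je \<union> Jg))"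
    by (rule measurable_gen_by_mono[OF e(1)] measurable_gen_by_mono[OF g(1)]; blast)+
  define h where "h = (\<lambda>\<omega>. H * e \<omega> + g \<omega>)"
  define p where "p = (\<lambda>\<omega>. cnj (H * e \<omega> + d * g \<omega>) * h \<omega>)"
  define t where "t = (\<lambda>\<omega>. cnj (e \<omega>) * g \<omega>)"
  have [measurable]: "h \<in> borel_measurable (gen_by X (Je \<union> Jg))"
    "p \<in> borel_measurable (gen_by X (Je \<union> Jg))"
    unfolding p_def h_def by measurable
  have mh: "all_moments M h" and mp: "all_moments M p" and mt: "all_moments M t"
    unfolding p_def h_def t_def by (intro all_moments_intros e g)+
  have Ju: "Ju \<inter> (Je \<union> Jg) = {}" using J by auto
  \<comment> \<open>All of \<open>u\<close> is collected in one summand; being independent of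
    \<open>e\<close> and \<open>g\<close> and centred, it contributes nothing to the mean and a
    product of powers to the second moment.\<close>
  have Y: "Y = (\<lambda>\<omega>. p \<omega> + cnj (u \<omega>) * h \<omega>)"
    unfolding Y_def p_def h_def by (simp add: algebra_simps)
  have cu: "expectation (\<lambda>\<omega>. cnj (u \<omega>)) = 0" using u(3) by simp
  have ee: "cnj (e \<omega>) * e \<omega> = 1" for \<omega>
    using e(4)[of \<omega>] complex_norm_square[of "e \<omega>"] by (simp add: mult.commute)
  have ct: "cmod (t \<omega>) = cmod (g \<omega>)" for \<omega> by (simp add: t_def norm_mult e(4))
  \<comment> \<open>Since \<open>e\<close> has modulus 1, the line-of-sight phases cancel and
    \<open>p\<close> depends on \<open>e\<close> and \<open>g\<close> through \<open>t\<close>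
    alone.\<close>
  have pt: "p \<omega> = (H + d * cnj (t \<omega>)) * (H + t \<omega>)" for \<omega>
  proof -
    have "p \<omega> = H * H * (cnj (e \<omega>) * e \<omega>) + H * (cnj (e \<omega>) * g \<omega>) + d * H * (cnj (g \<omega>) * e \<omega>)
        + d * (cnj (g \<omega>) * g \<omega>)"
      unfolding p_def h_def by (simp add: algebra_simps)
    also have "cnj (g \<omega>) * g \<omega> = cnj (t \<omega>) * t \<omega>"
      using ct[of \<omega>] complex_norm_square[of "g \<omega>"] complex_norm_square[of "t \<omega>"]
      by (simp add: mult.commute)
    finally show ?thesis unfolding ee by (simp add: t_def algebra_simps)
  qed
  have Et: "expectation t = 0"
    unfolding t_def
    by (subst expectation_mult_gen_by[OF X J(1)]) (use e g in \<open>auto intro: all_moments_intros\<close>)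
  \<comment> \<open>Here the circular symmetry of \<open>g\<close> enters, in the form that its
    square has mean zero.\<close>
  have Et2: "expectation (\<lambda>\<omega>. (t \<omega>)\<^sup>2) = 0"
    unfolding t_def power_mult_distrib
    by (subst expectation_mult_gen_by[OF X J(1)])
       (use e g in \<open>auto intro: all_moments_intros simp: power2_eq_square\<close>)
  have "expectation (\<lambda>\<omega>. of_real ((cmod (t \<omega>))\<^sup>2) * t \<omega>)
      = expectation (\<lambda>\<omega>. cnj (e \<omega>) * (of_real ((cmod (g \<omega>))\<^sup>2) * g \<omega>))"
    unfolding ct by (simp add: t_def algebra_simps)
  also have "\<dots> = 0"
    by (subst expectation_mult_gen_by[OF X J(1)])
       (use e g in \<open>auto intro!: all_moments_intros simp: power2_eq_square\<close>)
  finally have Et3: "expectation (\<lambda>\<omega>. of_real ((cmod (t \<omega>))\<^sup>2) * t \<omega>) = 0" .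

  have ig: "integrable M (\<lambda>\<omega>. (cmod (g \<omega>))\<^sup>2)" "integrable M (\<lambda>\<omega>. cmod (g \<omega>) ^ 4)"
    using g(2) unfolding all_moments_def by blast+
  have it: "integrable M t" "integrable M (\<lambda>\<omega>. (t \<omega>)\<^sup>2)"
    "integrable M (\<lambda>\<omega>. of_real ((cmod (t \<omega>))\<^sup>2) * t \<omega>)"
    by (auto simp: power2_eq_square intro!: all_moments_integrable all_moments_intros mt)

  have "p \<omega> = of_real (H\<^sup>2 + d * (cmod (g \<omega>))\<^sup>2) + (H * t \<omega> + H * d * cnj (t \<omega>))" for \<omega>
    unfolding pt ct[symmetric]
    by (simp add: algebra_simps power2_eq_square complex_norm_square[symmetric, unfolded power2_eq_square])
  then have "p = (\<lambda>\<omega>. of_real (H\<^sup>2 + d * (cmod (g \<omega>))\<^sup>2) + (H * t \<omega> + H * d * cnj (t \<omega>)))"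
    by blast
  then have "expectation p = of_real (H\<^sup>2 + d * \<beta>)"
    using ig it Et g(4) by (simp add: prob_space del: of_real_power of_real_mult of_real_add)
  moreover have "expectation (\<lambda>\<omega>. cnj (u \<omega>) * h \<omega>) = 0"
    using cu by (subst expectation_mult_gen_by[OF X Ju]) (auto intro: all_moments_intros u mh)
  ultimately show "expectation Y = of_real (H\<^sup>2 + d * \<beta>)"
    unfolding Y
    by (subst Bochner_Integration.integral_add)
       (auto intro!: all_moments_integrable all_moments_intros u mh mp)

  \<comment> \<open>\<open>w\<close> collects the terms of the expanded |H + d * cnj t|^2 * |H +
    t|^2 that are not functions of |t|. The mixed term 4 * H^2 * d * (Re t)^2 is split as 2 * H^2 *
    d * (|t|^2 + Re (t^2)): its second half goes into \<open>w\<close>, its first half into the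
    coefficient of |g|^2 below.\<close>
  define w where "w = (\<lambda>\<omega>. of_real (2 * H\<^sup>2 * d) * (t \<omega>)\<^sup>2 + of_real (2 * H ^ 3 * (1 + d)) * t \<omega>
      + of_real (2 * H * d * (1 + d)) * (of_real ((cmod (t \<omega>))\<^sup>2) * t \<omega>))"
  have iw: "integrable M w" unfolding w_def using it by simp
  have "expectation w = 0" unfolding w_def using it Et Et2 Et3 by simp
  then have Ew: "expectation (\<lambda>\<omega>. Re (w \<omega>)) = 0" using integral_Re[OF iw] by simp
  have "(cmod (p \<omega>))\<^sup>2 = H ^ 4 + (2 * H\<^sup>2 * d + H\<^sup>2 * (1 + d\<^sup>2)) * (cmod (g \<omega>))\<^sup>2
      + d\<^sup>2 * cmod (g \<omega>) ^ 4 + Re (w \<omega>)" for \<omega>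
  proof -
    have 4: "cmod (t \<omega>) ^ 4 = ((cmod (t \<omega>))\<^sup>2)\<^sup>2" by simp
    show ?thesis
      unfolding pt ct[symmetric] w_def 4 norm_mult power_mult_distrib
      unfolding cmod_power2
      by (simp add: power2_eq_square power3_eq_cube power4_eq_xxxx algebra_simps)
  qed
  then have Ep: "expectation (\<lambda>\<omega>. (cmod (p \<omega>))\<^sup>2)
      = H ^ 4 + (2 * H\<^sup>2 * d + H\<^sup>2 * (1 + d\<^sup>2)) * \<beta> + d\<^sup>2 * (2 * \<beta>\<^sup>2)"
    using ig integrable_Re[OF iw] Ew g(4,5) by (simp add: prob_space)
  have Eh: "expectation (\<lambda>\<omega>. (cmod (h \<omega>))\<^sup>2) = H\<^sup>2 + \<beta>"
    unfolding h_def by (rule ricean_moments(1)[OF X J e g(1-4) u])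
  have "expectation (\<lambda>\<omega>. (cmod (Y \<omega>))\<^sup>2)
      = expectation (\<lambda>\<omega>. (cmod (p \<omega>))\<^sup>2)
        + expectation (\<lambda>\<omega>. (cmod (cnj (u \<omega>)))\<^sup>2) * expectation (\<lambda>\<omega>. (cmod (h \<omega>))\<^sup>2)"
    unfolding Y
    by (rule second_moment_add_centred[OF X Ju])
       (auto intro: cu all_moments_intros u mh mp)
  then show "expectation (\<lambda>\<omega>. (cmod (Y \<omega>))\<^sup>2)
       = (H\<^sup>2 + d * \<beta>)\<^sup>2 + ((H\<^sup>2 + d\<^sup>2 * \<beta> + U) * (H\<^sup>2 + \<beta>) - H ^ 4)"
    unfolding Ep Eh complex_mod_cnj u(4)
    by (simp add: power2_eq_square power4_eq_xxxx algebra_simps)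
qed

text \<open>The estimate and the channel of another user have independent line-of-sight phases, so
  \<open>g\<close> is their only common source. The centred factors \<open>e'\<close>,
  \<open>e\<close> and \<open>u\<close> are split off one after the other, until only the second and
  fourth moments of \<open>g\<close> remain.\<close>

lemma mr_cross_channel_moments:
  fixes g e e' u :: "'a \<Rightarrow> complex" and H H' d \<beta> U :: real
  assumes X: "indep_vars (\<lambda>_. borel) X UNIV"
    and J: "Je \<inter> Jg = {}" "Je \<inter> Ju = {}" "Jg \<inter> Ju = {}"
    and J': "Je' \<inter> Je = {}" "Je' \<inter> Jg = {}" "Je' \<inter> Ju = {}"
    and e: "e \<in> borel_measurable (gen_by X Je)" "all_moments M e" "expectation e = 0"
      "\<And>\<omega>. cmod (e \<omega>) = 1"
    and e': "e' \<in> borel_measurable (gen_by X Je')" "all_moments M e'" "expectation e' = 0"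
      "\<And>\<omega>. cmod (e' \<omega>) = 1"
    and g: "g \<in> borel_measurable (gen_by X Jg)" "all_moments M g" "expectation g = 0"
      "expectation (\<lambda>\<omega>. (cmod (g \<omega>))\<^sup>2) = \<beta>" "expectation (\<lambda>\<omega>. (cmod (g \<omega>)) ^ 4) = 2 * \<beta>\<^sup>2"
    and u: "u \<in> borel_measurable (gen_by X Ju)" "all_moments M u" "expectation u = 0"
      "expectation (\<lambda>\<omega>. (cmod (u \<omega>))\<^sup>2) = U"
  defines "Y \<equiv> \<lambda>\<omega>. cnj (H * e \<omega> + d * g \<omega> + u \<omega>) * (H' * e' \<omega> + g \<omega>)"
  shows "expectation Y = of_real (d * \<beta>)"
    and "expectation (\<lambda>\<omega>. (cmod (Y \<omega>))\<^sup>2)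
       = (d * \<beta>)\<^sup>2 + (H\<^sup>2 + d\<^sup>2 * \<beta> + U) * (H'\<^sup>2 + \<beta>)"
proof -
  note [measurable] = e(1) e'(1) g(1) u(1)
  have meas [measurable]: "e \<in> borel_measurable (gen_by X (Je \<union> Je' \<union> Jg))"
    "e' \<in> borel_measurable (gen_by X (Je \<union> Je' \<union> Jg))"
    "g \<in> borel_measurable (gen_by X (Je \<union> Je' \<union> Jg))"
    "e' \<in> borel_measurable (gen_by X (Je' \<union> Jg))"
    "g \<in> borel_measurable (gen_by X (Je' \<union> Jg))"
    by (rule measurable_gen_by_mono[OF e(1)] measurable_gen_by_mono[OF e'(1)]
        measurable_gen_by_mono[OF g(1)]; blast)+
  define h where "h = (\<lambda>\<omega>. H' * e' \<omega> + g \<omega>)"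
  define q where "q = (\<lambda>\<omega>. d * (cnj (g \<omega>) * h \<omega>))"
  define p where "p = (\<lambda>\<omega>. q \<omega> + cnj (e \<omega>) * (H * h \<omega>))"
  have [measurable]: "h \<in> borel_measurable (gen_by X (Je' \<union> Jg))"
    "h \<in> borel_measurable (gen_by X (Je \<union> Je' \<union> Jg))"
    "q \<in> borel_measurable (gen_by X (Je' \<union> Jg))"
    "p \<in> borel_measurable (gen_by X (Je \<union> Je' \<union> Jg))"
    unfolding p_def q_def h_def by measurable
  have mh: "all_moments M h" and mq: "all_moments M q" and mp: "all_moments M p"
    unfolding p_def q_def h_def by (intro all_moments_intros e g e')+
  have Je: "Je \<inter> (Je' \<union> Jg) = {}" and Ju: "Ju \<inter> (Je \<union> Je' \<union> Jg) = {}" using J J' by auto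
  have Y: "Y = (\<lambda>\<omega>. p \<omega> + cnj (u \<omega>) * h \<omega>)"
    unfolding Y_def p_def q_def h_def by (simp add: algebra_simps)
  have cu: "expectation (\<lambda>\<omega>. cnj (u \<omega>)) = 0" and ce: "expectation (\<lambda>\<omega>. cnj (e \<omega>)) = 0"
    using u(3) e(3) by simp_all
  have ig: "integrable M (\<lambda>\<omega>. (cmod (g \<omega>))\<^sup>2)" "integrable M (\<lambda>\<omega>. e' \<omega> * cnj (g \<omega>))"
    using g(2) e'(2) by (auto intro!: all_moments_integrable all_moments_intros
        all_moments_integrable_square)
  \<comment> \<open>First splitting: a function of |g| plus a multiple of the centred
    \<open>e'\<close>.\<close>
  have gh: "cnj (g \<omega>) * h \<omega> = of_real ((cmod (g \<omega>))\<^sup>2) + e' \<omega> * (H' * cnj (g \<omega>))" for \<omega>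
    unfolding h_def by (simp add: algebra_simps complex_norm_square[symmetric])

  have "expectation (\<lambda>\<omega>. e' \<omega> * cnj (g \<omega>)) = 0"
    using e'(3) by (subst expectation_mult_gen_by[OF X J'(2)]) (auto intro: all_moments_intros e' g)
  then have "expectation q = d * \<beta>"
    using ig g(4) unfolding q_def gh
    by (simp add: mult.left_commute[of _ "of_real H'"] del: of_real_power)
  moreover have "expectation (\<lambda>\<omega>. cnj (e \<omega>) * (H * h \<omega>)) = 0"
    using ce by (subst expectation_mult_gen_by[OF X Je]) (auto intro!: all_moments_intros e mh)
  moreover have "expectation (\<lambda>\<omega>. cnj (u \<omega>) * h \<omega>) = 0"
    using cu by (subst expectation_mult_gen_by[OF X Ju]) (auto intro: all_moments_intros u mh)
  moreover have "integrable M q" "integrable M (\<lambda>\<omega>. cnj (e \<omega>) * (H * h \<omega>))"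
    "integrable M (\<lambda>\<omega>. cnj (u \<omega>) * h \<omega>)"
    by (intro all_moments_integrable all_moments_intros u mh mq e)+
  ultimately show "expectation Y = of_real (d * \<beta>)"
    unfolding Y p_def by simp

  have "expectation (\<lambda>\<omega>. (cmod (cnj (g \<omega>) * h \<omega>))\<^sup>2)
      = expectation (\<lambda>\<omega>. (cmod (of_real ((cmod (g \<omega>))\<^sup>2) :: complex))\<^sup>2)
        + expectation (\<lambda>\<omega>. (cmod (e' \<omega>))\<^sup>2) * expectation (\<lambda>\<omega>. (cmod (H' * cnj (g \<omega>)))\<^sup>2)"
    unfolding gh by (rule second_moment_add_centred[OF X J'(2)])
      (auto intro!: e' g all_moments_intros simp: power2_eq_square)
  also have "\<dots> = 2 * \<beta>\<^sup>2 + H'\<^sup>2 * \<beta>"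
    using g(4,5) by (simp add: e'(4) prob_space norm_mult power_mult_distrib norm_power)
  finally have Egh: "expectation (\<lambda>\<omega>. (cmod (cnj (g \<omega>) * h \<omega>))\<^sup>2) = 2 * \<beta>\<^sup>2 + H'\<^sup>2 * \<beta>" .
  have Eh: "expectation (\<lambda>\<omega>. (cmod (h \<omega>))\<^sup>2) = H'\<^sup>2 + \<beta>"
    unfolding h_def by (rule ricean_moments(1)[OF X J'(2,3) J(3) e' g(1-4) u])
  \<comment> \<open>Second splitting, at the phase factor of the estimated user; the last one, at
    \<open>u\<close>, follows.\<close>
  have "expectation (\<lambda>\<omega>. (cmod (p \<omega>))\<^sup>2)
      = expectation (\<lambda>\<omega>. (cmod (q \<omega>))\<^sup>2)
        + expectation (\<lambda>\<omega>. (cmod (cnj (e \<omega>)))\<^sup>2) * expectation (\<lambda>\<omega>. (cmod (H * h \<omega>))\<^sup>2)"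
    unfolding p_def by (rule second_moment_add_centred[OF X Je])
      (auto intro: ce all_moments_intros e mh mq)
  also have "\<dots> = d\<^sup>2 * (2 * \<beta>\<^sup>2 + H'\<^sup>2 * \<beta>) + H\<^sup>2 * (H'\<^sup>2 + \<beta>)"
    unfolding q_def norm_mult[of "of_real _"] power_mult_distrib
    using Egh Eh by (simp add: e(4) prob_space)
  finally have Ep: "expectation (\<lambda>\<omega>. (cmod (p \<omega>))\<^sup>2)
      = d\<^sup>2 * (2 * \<beta>\<^sup>2 + H'\<^sup>2 * \<beta>) + H\<^sup>2 * (H'\<^sup>2 + \<beta>)" .
  have "expectation (\<lambda>\<omega>. (cmod (Y \<omega>))\<^sup>2)
      = expectation (\<lambda>\<omega>. (cmod (p \<omega>))\<^sup>2)
        + expectation (\<lambda>\<omega>. (cmod (cnj (u \<omega>)))\<^sup>2) * expectation (\<lambda>\<omega>. (cmod (h \<omega>))\<^sup>2)"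
    unfolding Y by (rule second_moment_add_centred[OF X Ju])
      (auto intro: cu all_moments_intros u mh mp)
  then show "expectation (\<lambda>\<omega>. (cmod (Y \<omega>))\<^sup>2)
       = (d * \<beta>)\<^sup>2 + (H\<^sup>2 + d\<^sup>2 * \<beta> + U) * (H'\<^sup>2 + \<beta>)"
    unfolding Ep Eh complex_mod_cnj u(4) by (simp add: power2_eq_square algebra_simps)
qed

end

section \<open>Moments in the system model\<close>

text \<open>The factor that the estimator applies to the centred pilot observation.\<close>

definition est_gain :: "('m, 'k::finite, 't::finite, 'w) uplink \<Rightarrow> 'm \<Rightarrow> 'k \<Rightarrow> real" where
  "est_gain S m k = sqrt (phat S k) * beta S m k / lam S m k"

text \<open>The coefficient of the scattered channel of user \<open>l\<close> in the estimate for
  user \<open>k\<close>. The value 0 off the pilot group lets sums run over all users, and lets one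
  formula serve interferers with and without the same pilot.\<close>

definition leak :: "('m, 'k::finite, 't::finite, 'w) uplink \<Rightarrow> 'm \<Rightarrow> 'k \<Rightarrow> 'k \<Rightarrow> real" where
  "leak S m k l =
     (if l \<in> copilot S k then est_gain S m k * (sqrt (phat S l) * tau_p S) else 0)"

text \<open>The part \<open>u\<close> of the estimate that is independent of the scattered channel
  of the chosen user \<open>l\<close>; the splitting is made afresh for each
  \<open>l\<close>.\<close>

definition est_rest ::
  "('m, 'k::finite, 't::finite, 'w) uplink \<Rightarrow> 'm \<Rightarrow> 'k \<Rightarrow> 'k \<Rightarrow> 'w \<Rightarrow> complex" where
  "est_rest S m k l \<omega> =
     (\<Sum>l'\<in>UNIV - {l}. complex_of_real (leak S m k l') * gain S m l' \<omega>)
     + (\<Sum>t\<in>UNIV. complex_of_real (est_gain S m k) * cnj (pilot S (pilot_of S k) $ t)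
          * (noise S m \<omega> $ t))"

text \<open>The second moment of the estimate, and the diagonal entry of \<open>Z_mat\<close> at
  \<open>m\<close>.\<close>

definition est_power :: "('m, 'k::finite, 't::finite, 'w) uplink \<Rightarrow> 'm \<Rightarrow> 'k \<Rightarrow> real" where
  "est_power S m k = phat S k * tau_p S * (beta S m k)\<^sup>2 / lam S m k + (hbar S m k)\<^sup>2"

text \<open>Subtracting \<open>y_pilot_mean\<close> removes every line-of-sight term from the pilot
  observation, so only scattered channels and noise remain beside the known phase term.\<close>

lemma mmse_est_split:
  "mmse_est S m k \<omega> = complex_of_real (hbar S m k) * cis (phase S m k \<omega>)
     + complex_of_real (leak S m k l) * gain S m l \<omega> + est_rest S m k l \<omega>"
proof -
  let ?c = "complex_of_real (est_gain S m k)"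
  let ?n = "herm_inner (pilot S (pilot_of S k)) (noise S m \<omega>)"
  have "y_pilot S m k \<omega> - y_pilot_mean S m k \<omega>
      = (\<Sum>l\<in>copilot S k. complex_of_real (sqrt (phat S l) * tau_p S) * gain S m l \<omega>) + ?n"
    unfolding y_pilot_def y_pilot_mean_def chan_def
    by (simp add: distrib_left sum.distrib mult.assoc)
  then have "mmse_est S m k \<omega> = complex_of_real (hbar S m k) * cis (phase S m k \<omega>)
      + (\<Sum>l\<in>copilot S k. ?c * (complex_of_real (sqrt (phat S l) * tau_p S) * gain S m l \<omega>))
      + ?c * ?n"
    unfolding mmse_est_def est_gain_def by (simp add: distrib_left sum_distrib_left add_divide_distrib sum_divide_distrib)
  also have "(\<Sum>l\<in>copilot S k. ?c * (complex_of_real (sqrt (phat S l) * tau_p S) * gain S m l \<omega>))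
      = (\<Sum>l\<in>UNIV. complex_of_real (leak S m k l) * gain S m l \<omega>)"
    by (rule sum.mono_neutral_cong_left) (auto simp: leak_def mult.assoc)
  also have "\<dots> = complex_of_real (leak S m k l) * gain S m l \<omega>
      + (\<Sum>l'\<in>UNIV - {l}. complex_of_real (leak S m k l') * gain S m l' \<omega>)"
    by (rule sum.remove) auto
  finally show ?thesis
    unfolding est_rest_def herm_inner_def by (simp add: sum_distrib_left mult.assoc)
qed

context cell_free_uplink
begin

section \<open>The sources on which each ingredient of the model depends\<close>

lemma lam_pos: "0 < lam S m k"
  unfolding lam_def tau_p_def using sigma2_pos phat_pos beta_pos
  by (intro add_nonneg_pos sum_nonneg) (auto simp: less_imp_le)

lemma tau_p_pos: "0 < tau_p S"
  by (simp add: tau_p_def)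

abbreviation decided_by :: "('m, 'k, 't) source set \<Rightarrow> 'w measure" where
  "decided_by \<equiv> gen_by (source_rv S)"

lemma source_rv_eq:
  "source_rv S (Gain m l) = gain S m l" "source_rv S (Noise m t) = (\<lambda>\<omega>. noise S m \<omega> $ t)"
  by auto

lemma gain_decided: "gain S m l \<in> borel_measurable (decided_by {Gain m l})"
  using measurable_gen_by_source[of "Gain m l" "{Gain m l}" "source_rv S"]
  by (simp add: source_rv_eq)

lemma noise_decided: "(\<lambda>\<omega>. noise S m \<omega> $ t) \<in> borel_measurable (decided_by {Noise m t})"
  using measurable_gen_by_source[of "Noise m t" "{Noise m t}" "source_rv S"]
  by (simp add: source_rv_eq)

lemma cis_phase_decided: "(\<lambda>\<omega>. cis (phase S m l \<omega>)) \<in> borel_measurable (decided_by {Phase m l})"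
proof -
  have "source_rv S (Phase m l) \<in> borel_measurable (decided_by {Phase m l})"
    by (rule measurable_gen_by_source) simp
  \<comment> \<open>The source is the phase embedded into the complex numbers; its real part
    recovers the phase.\<close>
  then have "(\<lambda>\<omega>. Re (source_rv S (Phase m l) \<omega>)) \<in> borel_measurable (decided_by {Phase m l})"
    by measurable
  from measurable_compose[OF this borel_measurable_cis] show ?thesis by simp
qed

lemmas phase_moments = cis_uniform[OF phase_uniform]
lemmas gain_moments = circ_gaussian_moments[OF gain_gaussian beta_pos]
lemmas noise_moments = circ_gaussian_moments[OF noise_gaussian sigma2_pos]

text \<open>Scattering and noise together contribute \<open>est_gain\<close>^2 *
  \<open>tau_p\<close> * \<open>lam\<close> to the power of the estimate; the last claim subtracts
  the share of user \<open>l\<close>.\<close>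

lemma est_rest_moments:
  shows "est_rest S m k l \<in> borel_measurable
           (decided_by (Gain m ` (UNIV - {l}) \<union> range (Noise m)))"
    and "all_moments (sample S) (est_rest S m k l)"
    and "expectation (est_rest S m k l) = 0"
    and "expectation (\<lambda>\<omega>. (cmod (est_rest S m k l \<omega>))\<^sup>2)
       = (est_gain S m k)\<^sup>2 * tau_p S * lam S m k - (leak S m k l)\<^sup>2 * beta S m l"
proof -
  let ?c = "\<lambda>t. complex_of_real (est_gain S m k) * cnj (pilot S (pilot_of S k) $ t)"
  define f where "f = (\<lambda>\<omega>. \<Sum>l'\<in>UNIV - {l}. complex_of_real (leak S m k l') * gain S m l' \<omega>)"
  define w where "w = (\<lambda>\<omega>. \<Sum>t\<in>UNIV. ?c t * (noise S m \<omega> $ t))"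
  have r: "est_rest S m k l = (\<lambda>\<omega>. f \<omega> + w \<omega> * 1)"
    by (simp add: est_rest_def f_def w_def fun_eq_iff)
  have f: "f \<in> borel_measurable (decided_by (Gain m ` (UNIV - {l})))"
    unfolding f_def by (intro borel_measurable_sum borel_measurable_times borel_measurable_const
        measurable_gen_by_mono[OF gain_decided]) auto
  have w: "w \<in> borel_measurable (decided_by (range (Noise m)))"
    unfolding w_def by (intro borel_measurable_sum borel_measurable_times borel_measurable_const
        measurable_gen_by_mono[OF noise_decided]) auto
  show "est_rest S m k l \<in> borel_measurable
      (decided_by (Gain m ` (UNIV - {l}) \<union> range (Noise m)))"
    unfolding r by (intro borel_measurable_add borel_measurable_times borel_measurable_const
        measurable_gen_by_mono[OF f] measurable_gen_by_mono[OF w]) auto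
  have mf: "all_moments (sample S) f" unfolding f_def by (intro all_moments_intros gain_moments)
  have mw: "all_moments (sample S) w" unfolding w_def by (intro all_moments_intros noise_moments)
  show "all_moments (sample S) (est_rest S m k l)" unfolding r by (intro all_moments_intros mf mw)
  have Ef: "expectation f = 0"
    unfolding f_def using all_moments_integrable[OF gain_moments(1)] gain_moments(2) by simp
  have Ew: "expectation w = 0"
    unfolding w_def using all_moments_integrable[OF noise_moments(1)] noise_moments(2) by simp
  show "expectation (est_rest S m k l) = 0"
    unfolding r using Ef Ew all_moments_integrable[OF mf] all_moments_integrable[OF mw] by simp
  have Vf: "expectation (\<lambda>\<omega>. (cmod (f \<omega>))\<^sup>2) = (\<Sum>l'\<in>UNIV - {l}. (leak S m k l')\<^sup>2 * beta S m l')"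
    unfolding f_def
    by (subst second_moment_sum_centred[OF sources_indep, where K = "\<lambda>l. {Gain m l}"])
       (auto simp: disjoint_family_on_def gain_moments gain_decided)
  have "expectation (\<lambda>\<omega>. (cmod (w \<omega>))\<^sup>2) = (\<Sum>t\<in>UNIV. (cmod (?c t))\<^sup>2 * sigma2 S)"
    unfolding w_def
    by (subst second_moment_sum_centred[OF sources_indep, where K = "\<lambda>t. {Noise m t}"])
       (auto simp: disjoint_family_on_def noise_moments noise_decided)
  also have "\<dots> = (est_gain S m k)\<^sup>2 * (\<Sum>t\<in>UNIV. (cmod (pilot S (pilot_of S k) $ t))\<^sup>2) * sigma2 S"
    by (simp add: norm_mult power_mult_distrib sum_distrib_left sum_distrib_right)
  also have "(\<Sum>t\<in>UNIV. (cmod (pilot S (pilot_of S k) $ t))\<^sup>2) = tau_p S"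
    using pilot_norm[of "pilot_of S k"] by (simp add: norm_vec_def L2_set_def sum_nonneg)
  finally have Vw: "expectation (\<lambda>\<omega>. (cmod (w \<omega>))\<^sup>2) = (est_gain S m k)\<^sup>2 * tau_p S * sigma2 S" .
  have "expectation (\<lambda>\<omega>. (cmod (est_rest S m k l \<omega>))\<^sup>2)
      = expectation (\<lambda>\<omega>. (cmod (f \<omega>))\<^sup>2)
        + expectation (\<lambda>\<omega>. (cmod (w \<omega>))\<^sup>2) * expectation (\<lambda>\<omega>. (cmod 1)\<^sup>2)"
    unfolding r by (rule second_moment_add_centred[OF sources_indep _ w f])
      (auto intro: mw mf Ew all_moments_const)
  then have "expectation (\<lambda>\<omega>. (cmod (est_rest S m k l \<omega>))\<^sup>2)
      = (\<Sum>l'\<in>UNIV - {l}. (leak S m k l')\<^sup>2 * beta S m l')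
        + (est_gain S m k)\<^sup>2 * tau_p S * sigma2 S"
    unfolding Vf Vw by (simp add: prob_space)
  also have "(\<Sum>l'\<in>UNIV - {l}. (leak S m k l')\<^sup>2 * beta S m l')
      = (\<Sum>l'\<in>UNIV. (leak S m k l')\<^sup>2 * beta S m l') - (leak S m k l)\<^sup>2 * beta S m l"
    by (simp add: sum_diff1)
  \<comment> \<open>On the pilot group \<open>leak\<close>^2 contains \<open>tau_p\<close> squared;
    one factor is pulled out with \<open>est_gain\<close>^2, the other completes the summand of
    \<open>lam\<close>.\<close>
  also have "(\<Sum>l'\<in>UNIV. (leak S m k l')\<^sup>2 * beta S m l')
      = (\<Sum>l'\<in>copilot S k. (est_gain S m k)\<^sup>2 * tau_p S * (phat S l' * tau_p S * beta S m l'))"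
    using phat_pos
    by (intro sum.mono_neutral_cong_right)
       (auto simp: leak_def power_mult_distrib power2_eq_square[of "tau_p S"] less_imp_le)
  finally show "expectation (\<lambda>\<omega>. (cmod (est_rest S m k l \<omega>))\<^sup>2)
       = (est_gain S m k)\<^sup>2 * tau_p S * lam S m k - (leak S m k l)\<^sup>2 * beta S m l"
    by (simp add: lam_def distrib_left sum_distrib_left)
qed

lemma est_power_alt: "est_power S m k = (est_gain S m k)\<^sup>2 * tau_p S * lam S m k + (hbar S m k)\<^sup>2"
  using lam_pos[of m k] phat_pos[of k] unfolding est_power_def est_gain_def
  by (simp add: power_divide power_mult_distrib less_imp_le power2_eq_square)

text \<open>All sources at one access point. These sets are disjoint for different access points,
  which makes the local products of estimate and channel independent.\<close>

definition ap_sources :: "'m \<Rightarrow> ('m, 'k, 't) source set" where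
  "ap_sources m = range (Phase m) \<union> range (Gain m) \<union> range (Noise m)"

lemma disjoint_ap_sources: "disjoint_family_on ap_sources A"
  by (auto simp: disjoint_family_on_def ap_sources_def)

lemma chan_ap:
  "chan S m l \<in> borel_measurable (decided_by (ap_sources m))" "all_moments (sample S) (chan S m l)"
proof -
  show "chan S m l \<in> borel_measurable (decided_by (ap_sources m))"
    unfolding chan_def[abs_def]
    by (intro borel_measurable_add borel_measurable_times borel_measurable_const
        measurable_gen_by_mono[OF cis_phase_decided] measurable_gen_by_mono[OF gain_decided])
       (auto simp: ap_sources_def)
  show "all_moments (sample S) (chan S m l)"
    unfolding chan_def[abs_def] by (intro all_moments_intros phase_moments gain_moments)
qed

lemma mmse_est_ap:
  "mmse_est S m k \<in> borel_measurable (decided_by (ap_sources m))"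
  "all_moments (sample S) (mmse_est S m k)"
proof -
  show "mmse_est S m k \<in> borel_measurable (decided_by (ap_sources m))"
    unfolding mmse_est_split[of S m k _ k, abs_def]
    by (intro borel_measurable_add borel_measurable_times borel_measurable_const
        measurable_gen_by_mono[OF cis_phase_decided] measurable_gen_by_mono[OF gain_decided]
        measurable_gen_by_mono[OF est_rest_moments(1)])
       (auto simp: ap_sources_def)
  show "all_moments (sample S) (mmse_est S m k)"
    unfolding mmse_est_split[of S m k _ k, abs_def]
    by (intro all_moments_intros phase_moments gain_moments est_rest_moments)
qed

text \<open>The splitting at \<open>l = k\<close> is used; the share subtracted in \<open>U\<close>
  is restored by the scattered term.\<close>

lemma mmse_est_power: "expectation (\<lambda>\<omega>. (cmod (mmse_est S m k \<omega>))\<^sup>2) = est_power S m k"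
  unfolding mmse_est_split[of S m k _ k]
  by (subst ricean_moments(2)[OF sources_indep, where Je = "{Phase m k}" and Jg = "{Gain m k}"
        and Ju = "Gain m ` (UNIV - {k}) \<union> range (Noise m)"
        and U = "(est_gain S m k)\<^sup>2 * tau_p S * lam S m k - (leak S m k k)\<^sup>2 * beta S m k"])
     (auto simp: est_power_alt intro: cis_phase_decided phase_moments gain_decided
       gain_moments est_rest_moments)

text \<open>The line-of-sight part contributes only for \<open>l = k\<close>, since independent
  phases average out.\<close>

definition mr_mean :: "'m \<Rightarrow> 'k \<Rightarrow> 'k \<Rightarrow> real" where
  "mr_mean m k l = leak S m k l * beta S m l + (if l = k then (hbar S m k)\<^sup>2 else 0)"

text \<open>The squared mean is kept as a separate summand, so that the remaining one is the
  variance. For the own channel the line-of-sight parts multiply to a deterministic number, whence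
  the subtracted fourth power.\<close>

lemma mr_product_moments:
  shows "expectation (\<lambda>\<omega>. cnj (mmse_est S m k \<omega>) * chan S m l \<omega>) = of_real (mr_mean m k l)"
    and "expectation (\<lambda>\<omega>. (cmod (cnj (mmse_est S m k \<omega>) * chan S m l \<omega>))\<^sup>2)
       = (mr_mean m k l)\<^sup>2 + (est_power S m k * ((hbar S m l)\<^sup>2 + beta S m l)
           - (if l = k then (hbar S m k) ^ 4 else 0))"
proof -
  let ?U = "(est_gain S m k)\<^sup>2 * tau_p S * lam S m k - (leak S m k l)\<^sup>2 * beta S m l"
  let ?Ju = "Gain m ` (UNIV - {l}) \<union> range (Noise m)"
  have p: "est_power S m k = (hbar S m k)\<^sup>2 + (leak S m k l)\<^sup>2 * beta S m l + ?U"
    by (simp add: est_power_alt)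
  have J: "{Phase m k} \<inter> {Gain m l} = {}" "{Phase m k} \<inter> ?Ju = {}" "{Gain m l} \<inter> ?Ju = {}"
    by auto
  note r = est_rest_moments[of m k l]
  have c: "cmod (cis (phase S m k \<omega>)) = 1" for k \<omega> by simp
  have "expectation (\<lambda>\<omega>. cnj (mmse_est S m k \<omega>) * chan S m l \<omega>) = of_real (mr_mean m k l)
    \<and> expectation (\<lambda>\<omega>. (cmod (cnj (mmse_est S m k \<omega>) * chan S m l \<omega>))\<^sup>2)
       = (mr_mean m k l)\<^sup>2 + (est_power S m k * ((hbar S m l)\<^sup>2 + beta S m l)
           - (if l = k then (hbar S m k) ^ 4 else 0))"
  proof (cases "l = k")
    case True
    note own = mr_own_channel_moments[OF sources_indep J cis_phase_decided phase_moments c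
        gain_decided gain_moments(1,2,4,5,3,6) r, of "hbar S m k" "leak S m k l"]
    show ?thesis
      unfolding mmse_est_split[of S m k _ l] chan_def mr_mean_def p
      using own True by (simp add: add.commute)
  next
    case False
    have J': "{Phase m l} \<inter> {Phase m k} = {}" "{Phase m l} \<inter> {Gain m l} = {}"
      "{Phase m l} \<inter> ?Ju = {}" using False by auto
    note cross = mr_cross_channel_moments[OF sources_indep J J' cis_phase_decided phase_moments c
        cis_phase_decided phase_moments c gain_decided gain_moments(1,2,4,5) r,
        of "hbar S m k" "leak S m k l" "hbar S m l"]
    show ?thesis
      unfolding mmse_est_split[of S m k _ l] chan_def mr_mean_def p
      using cross False by simp
  qed
  then show "expectation (\<lambda>\<omega>. cnj (mmse_est S m k \<omega>) * chan S m l \<omega>) = of_real (mr_mean m k l)"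
    and "expectation (\<lambda>\<omega>. (cmod (cnj (mmse_est S m k \<omega>) * chan S m l \<omega>))\<^sup>2)
       = (mr_mean m k l)\<^sup>2 + (est_power S m k * ((hbar S m l)\<^sup>2 + beta S m l)
           - (if l = k then (hbar S m k) ^ 4 else 0))"
    by blast+
qed

end

section \<open>Diagonal matrices and positive definite forms\<close>

lemma ctransp_diag_mat: "ctransp (diag_mat d) = diag_mat (\<chi> i. cnj (d $ i))"
  by (auto simp: ctransp_def diag_mat_def vec_eq_iff)

lemma diag_mat_mult_vec: "diag_mat d *v x = (\<chi> i. d $ i * x $ i)"
  by (simp add: diag_mat_def matrix_vector_mult_def vec_eq_iff if_distrib[of "\<lambda>z. z * _"] cong: if_cong)

lemma diag_mat_mult: "diag_mat d ** diag_mat e = diag_mat (\<chi> i. d $ i * e $ i)"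
  by (auto simp: diag_mat_def matrix_matrix_mult_def vec_eq_iff if_distrib[of "\<lambda>z. z * _"] cong: if_cong)

lemma diag_mat_add: "diag_mat d + diag_mat e = diag_mat (d + e)"
  by (auto simp: diag_mat_def vec_eq_iff)

lemma diag_mat_diff: "diag_mat d - diag_mat e = diag_mat (d - e)"
  by (auto simp: diag_mat_def vec_eq_iff)

lemma diag_mat_scaleR: "c *\<^sub>R diag_mat d = diag_mat (\<chi> i. complex_of_real c * d $ i)"
  by (simp add: diag_mat_def vec_eq_iff) (simp add: scaleR_conv_of_real)

lemma diag_mat_sum: "(\<Sum>l\<in>A. diag_mat (f l)) = diag_mat (\<Sum>l\<in>A. f l)"
  by (induction A rule: infinite_finite_induct) (auto simp: diag_mat_add, auto simp: diag_mat_def vec_eq_iff)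

lemma trace_diag_mat: "trace (diag_mat d) = (\<Sum>i\<in>UNIV. d $ i)"
  by (simp add: trace_def diag_mat_def)

lemma diag_vec_diag_mat: "diag_vec (diag_mat d) = d"
  by (simp add: diag_vec_def diag_mat_def vec_eq_iff)

lemma matrix_inv_right:
  fixes A :: "'a::semiring_1^'n^'n"
  assumes "invertible A"
  shows "A ** matrix_inv A = mat 1"
  using assms unfolding invertible_def matrix_inv_def by (metis (mono_tags, lifting) someI_ex)

lemma matrix_inv_unique:
  fixes A B :: "'a::field^'n^'n"
  assumes "B ** A = mat 1"
  shows "matrix_inv A = B"
proof -
  have "invertible A" using assms by (auto simp: invertible_left_inverse)
  then show ?thesis
    by (metis assms matrix_inv_right matrix_mul_assoc matrix_mul_lid matrix_mul_rid)
qed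

lemma matrix_inv_diag_mat:
  assumes "\<And>i. d $ i \<noteq> 0"
  shows "matrix_inv (diag_mat d) = diag_mat (\<chi> i. inverse (d $ i))"
  by (rule matrix_inv_unique, unfold diag_mat_mult)
     (simp add: assms diag_mat_def mat_def vec_eq_iff)

text \<open>Turns the traces of the denominator into real sums with weights |a_i|^2.\<close>

lemma trace_diag_congruence:
  "trace (ctransp (diag_mat a) ** diag_mat (\<chi> i. complex_of_real (w i)) ** diag_mat a)
     = complex_of_real (\<Sum>i\<in>UNIV. (cmod (a $ i))\<^sup>2 * w i)"
proof -
  have e: "cnj (a $ i) * complex_of_real (w i) * a $ i
      = complex_of_real ((cmod (a $ i))\<^sup>2 * w i)" for i
    unfolding of_real_mult complex_norm_square by (simp add: mult_ac)
  show ?thesis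
    unfolding ctransp_diag_mat diag_mat_mult trace_diag_mat of_real_sum
    by (intro sum.cong refl) (simp only: vec_lambda_beta e)
qed

section \<open>Calculus of Hermitian products and rank-one matrices\<close>

lemma herm_inner_add: "herm_inner u (v + w) = herm_inner u v + herm_inner u w"
  by (simp add: herm_inner_def distrib_left sum.distrib)

lemma herm_inner_diff: "herm_inner u (v - w) = herm_inner u v - herm_inner u w"
  by (simp add: herm_inner_def right_diff_distrib sum_subtractf)

lemma herm_inner_diff_left: "herm_inner (u - v) w = herm_inner u w - herm_inner v w"
  by (simp add: herm_inner_def left_diff_distrib sum_subtractf)

lemma herm_inner_scale: "herm_inner u (c *s v) = c * herm_inner u v"
  by (simp add: herm_inner_def sum_distrib_left mult.left_commute)

lemma herm_inner_scale_left: "herm_inner (c *s u) v = cnj c * herm_inner u v"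
  by (simp add: herm_inner_def sum_distrib_left mult.assoc)

lemma cnj_herm_inner: "cnj (herm_inner u v) = herm_inner v u"
  by (simp add: herm_inner_def mult.commute)

lemma herm_inner_diag_mat:
  "herm_inner a (diag_mat (\<chi> i. complex_of_real (w i)) *v a')
     = (\<Sum>i\<in>UNIV. complex_of_real (w i) * (cnj (a $ i) * a' $ i))"
  by (simp add: herm_inner_def diag_mat_mult_vec mult_ac)

lemma outer_mult_vec: "outer u w *v x = herm_inner w x *s u"
  by (simp add: outer_def matrix_vector_mult_def herm_inner_def vec_eq_iff
      sum_distrib_left mult_ac)

lemma herm_inner_outer: "herm_inner a (outer u u *v a) = complex_of_real ((cmod (herm_inner u a))\<^sup>2)"
  unfolding outer_mult_vec herm_inner_scale complex_norm_square cnj_herm_inner ..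

lemma cmod_herm_inner_commute: "cmod (herm_inner u v) = cmod (herm_inner v u)"
  by (metis cnj_herm_inner complex_mod_cnj)

lemma matrix_mult_vec_sum: "(\<Sum>l\<in>A. F l) *v x = (\<Sum>l\<in>A. (F l :: complex^'n^'m) *v x)"
  by (induction A rule: infinite_finite_induct) (auto simp: matrix_vector_mult_add_rdistrib)

lemma herm_inner_sum: "herm_inner u (\<Sum>l\<in>A. f l) = (\<Sum>l\<in>A. herm_inner u (f l))"
  by (induction A rule: infinite_finite_induct) (auto simp: herm_inner_add, auto simp: herm_inner_def)

lemma scaleR_matrix_mult_vec: "(c *\<^sub>R F) *v x = complex_of_real c *s (F *v (x :: complex^'n))"
  by (simp add: matrix_vector_mult_def vec_eq_iff sum_distrib_left)
     (simp add: scaleR_conv_of_real mult_ac)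

section \<open>Positive definite Hermitian forms\<close>

locale pos_def =
  fixes G :: "complex^'n^'n"
  assumes hermitian: "herm_inner x (G *v y) = cnj (herm_inner y (G *v x))"
    and positive: "x \<noteq> 0 \<Longrightarrow> 0 < Re (herm_inner x (G *v x))"
begin

lemma form_real: "herm_inner x (G *v x) = complex_of_real (Re (herm_inner x (G *v x)))"
  using hermitian[of x x] by (simp add: complex_eq_iff)

text \<open>A vector in the kernel has form value 0, hence is zero.\<close>

lemma invertible: "invertible G"
  unfolding invertible_left_inverse matrix_left_invertible_ker
  using positive by (fastforce simp: herm_inner_def)

lemma inv_cancel: "G *v (matrix_inv G *v b) = b"
  by (simp add: matrix_vector_mul_assoc matrix_inv_right[OF invertible])

lemma inv_nonzero: "b \<noteq> 0 \<Longrightarrow> matrix_inv G *v b \<noteq> 0"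
  using inv_cancel[of b] by auto

lemma cauchy_schwarz:
  "(cmod (herm_inner a (G *v x)))\<^sup>2 \<le> Re (herm_inner a (G *v a)) * Re (herm_inner x (G *v x))"
proof (cases "x = 0")
  case True
  then show ?thesis by (simp add: herm_inner_def)
next
  case False
  define t where "t = Re (herm_inner x (G *v x))"
  define r where "r = Re (herm_inner a (G *v a))"
  define s where "s = herm_inner x (G *v a)"
  have t: "0 < t" and tt: "herm_inner x (G *v x) = of_real t"
    and rr: "herm_inner a (G *v a) = of_real r"
    using positive[OF False] form_real unfolding t_def r_def by blast+
  have s': "herm_inner a (G *v x) = cnj s" unfolding s_def by (rule hermitian)
  \<comment> \<open>\<open>d\<close> is \<open>t\<close> times the component of \<open>a\<close>
    orthogonal to \<open>x\<close> for the form; the scaling by \<open>t\<close> avoids a division.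
    Its form value is \<open>t\<close> times the desired difference.\<close>
  define d where "d = of_real t *s a - s *s x"
  have "herm_inner d (G *v d) = of_real (t * (t * r - (cmod s)\<^sup>2))"
    unfolding d_def matrix_vector_mult_diff_distrib vector_scalar_commute herm_inner_diff
      herm_inner_diff_left herm_inner_scale herm_inner_scale_left tt rr s' s_def[symmetric]
    by (simp add: algebra_simps complex_norm_square[symmetric] del: of_real_power)
  moreover have "0 \<le> Re (herm_inner d (G *v d))"
    using positive[of d] by (cases "d = 0") (auto simp: herm_inner_def)
  ultimately have "0 \<le> t * (t * r - (cmod s)\<^sup>2)" by simp
  then have "(cmod s)\<^sup>2 \<le> t * r" using t by (simp add: zero_le_mult_iff)
  then show ?thesis unfolding s' t_def[symmetric] r_def[symmetric] by (simp add: mult.commute)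
qed

end


section \<open>Closed form and optimal decoding vector\<close>

context cell_free_uplink
begin

section \<open>The SINR as a quotient of real sums\<close>

lemma est_power_pos: "0 < est_power S m k"
  unfolding est_power_def using phat_pos[of k] tau_p_pos beta_pos[of m k] lam_pos[of m k]
  by (intro add_pos_nonneg divide_pos_pos mult_pos_pos) auto

text \<open>The MMSE property: the estimate has the same correlation with the channel as with
  itself. Therefore \<open>Z_mat\<close> determines both the desired signal and the filtered
  noise.\<close>

lemma mr_mean_own: "mr_mean m k k = est_power S m k"
  using phat_pos[of k]
  by (simp add: mr_mean_def est_power_def leak_def est_gain_def copilot_def power2_eq_square)

text \<open>The diagonal part of \<open>Gamma_mat\<close>, without the rank-one contributions of
  pilot contamination.\<close>

definition noise_weight :: "'k \<Rightarrow> 'm \<Rightarrow> real" where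
  "noise_weight k m =
     (\<Sum>l\<in>UNIV. pdata S l * (est_power S m k * ((hbar S m l)\<^sup>2 + beta S m l)))
     - pdata S k * (hbar S m k) ^ 4 + sigma2 S * est_power S m k"

text \<open>The common real value of the three denominators: of the defining SINR, of the trace
  formula and of the Rayleigh quotient.\<close>

definition sinr_den :: "'k \<Rightarrow> complex^'m \<Rightarrow> real" where
  "sinr_den k a = (\<Sum>m\<in>UNIV. (cmod (a $ m))\<^sup>2 * noise_weight k m)
     + (\<Sum>l\<in>copilot S k - {k}. pdata S l *
          (cmod (\<Sum>m\<in>UNIV. cnj (a $ m) * complex_of_real (leak S m k l * beta S m l)))\<^sup>2)"

text \<open>The negative term is absorbed by the summand \<open>l = k\<close>; the noise term makes
  the inequality strict.\<close>

lemma noise_weight_pos: "0 < noise_weight k m"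
proof -
  let ?f = "\<lambda>l. pdata S l * (est_power S m k * ((hbar S m l)\<^sup>2 + beta S m l))"
  have nn: "0 \<le> ?f l" for l
    using pdata_nonneg[of l] est_power_pos[of m k] beta_pos[of m l] by simp
  have "(hbar S m k)\<^sup>2 * (hbar S m k)\<^sup>2 \<le> est_power S m k * ((hbar S m k)\<^sup>2 + beta S m k)"
    using phat_pos[of k] tau_p_pos lam_pos[of m k] beta_pos[of m k] unfolding est_power_def
    by (intro mult_mono) auto
  then have "pdata S k * (hbar S m k) ^ 4 \<le> ?f k"
    using pdata_nonneg[of k] by (intro mult_left_mono) (auto simp: power4_eq_xxxx power2_eq_square mult.assoc)
  also have "\<dots> \<le> (\<Sum>l\<in>UNIV. ?f l)" by (rule member_le_sum) (use nn in auto)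
  finally show ?thesis
    using mult_pos_pos[OF sigma2_pos est_power_pos[of m k]] unfolding noise_weight_def by linarith
qed

lemma sinr_den_pos:
  assumes "a \<noteq> 0"
  shows "0 < sinr_den k a"
proof -
  obtain m where "a $ m \<noteq> 0" using assms by (auto simp: vec_eq_iff)
  then have "0 < (\<Sum>m\<in>UNIV. (cmod (a $ m))\<^sup>2 * noise_weight k m)"
    using noise_weight_pos by (intro sum_pos2[of _ m]) (auto simp: less_imp_le)
  then show ?thesis
    unfolding sinr_den_def using pdata_nonneg by (intro add_pos_nonneg sum_nonneg) auto
qed

lemma combined_eq:
  "herm_inner (mr_mmse S k \<omega>) (ctransp (diag_mat a) *v chan_vec S l \<omega>)
     = (\<Sum>m\<in>UNIV. cnj (a $ m) * (cnj (mmse_est S m k \<omega>) * chan S m l \<omega>))"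
  by (simp add: herm_inner_def mr_mmse_def chan_vec_def ctransp_diag_mat diag_mat_mult_vec mult_ac)

lemma mr_product_ap:
  "(\<lambda>\<omega>. cnj (mmse_est S m k \<omega>) * chan S m l \<omega>) \<in> borel_measurable (decided_by (ap_sources m))"
  "all_moments (sample S) (\<lambda>\<omega>. cnj (mmse_est S m k \<omega>) * chan S m l \<omega>)"
  by (intro borel_measurable_times borel_measurable_cnj all_moments_intros mmse_est_ap chan_ap)+

lemma desired_power_eq:
  "desired_power S (mr_mmse S k) a k
     = pdata S k * (cmod (\<Sum>m\<in>UNIV. cnj (a $ m) * complex_of_real (est_power S m k)))\<^sup>2"
  unfolding desired_power_def combined_eq
  using all_moments_integrable[OF mr_product_ap(2)]
  by (simp add: mr_product_moments mr_mean_own)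

text \<open>The squared means in \<open>mr_product_moments\<close> cancel against those subtracted
  in \<open>second_moment_sum\<close>; the means reappear only as a coherent sum over access
  points.\<close>

lemma combined_power:
  "expectation (\<lambda>\<omega>. (cmod (herm_inner (mr_mmse S k \<omega>) (ctransp (diag_mat a) *v chan_vec S l \<omega>)))\<^sup>2)
     = (\<Sum>m\<in>UNIV. (cmod (a $ m))\<^sup>2 * (est_power S m k * ((hbar S m l)\<^sup>2 + beta S m l)
          - (if l = k then (hbar S m k) ^ 4 else 0)))
       + (cmod (\<Sum>m\<in>UNIV. cnj (a $ m) * complex_of_real (mr_mean m k l)))\<^sup>2"
  unfolding combined_eq
  by (subst second_moment_sum[OF sources_indep disjoint_ap_sources])
     (auto simp: mr_product_moments intro: mr_product_ap)

lemma filter_noise_power: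
  "expectation (\<lambda>\<omega>. (norm (diag_mat a *v mr_mmse S k \<omega>))\<^sup>2)
     = (\<Sum>m\<in>UNIV. (cmod (a $ m))\<^sup>2 * est_power S m k)"
proof -
  have "(norm (diag_mat a *v mr_mmse S k \<omega>))\<^sup>2
      = (\<Sum>m\<in>UNIV. (cmod (a $ m))\<^sup>2 * (cmod (mmse_est S m k \<omega>))\<^sup>2)" for \<omega>
    by (simp add: diag_mat_mult_vec mr_mmse_def norm_vec_def L2_set_def sum_nonneg norm_mult
        power_mult_distrib)
  then show ?thesis
    using all_moments_integrable_square[OF mmse_est_ap(2)] by (simp add: mmse_est_power)
qed

lemma interference_noise_power_eq:
  "interference_noise_power S (mr_mmse S k) a k = sinr_den k a"
proof -
  let ?c = "\<lambda>l. (cmod (\<Sum>m\<in>UNIV. cnj (a $ m) * complex_of_real (mr_mean m k l)))\<^sup>2"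
  let ?e = "\<lambda>l m. est_power S m k * ((hbar S m l)\<^sup>2 + beta S m l)"
  let ?n = "\<lambda>m. (cmod (a $ m))\<^sup>2"
  have "(\<Sum>l\<in>UNIV. pdata S l * ?c l) = pdata S k * ?c k + (\<Sum>l\<in>UNIV - {k}. pdata S l * ?c l)"
    by (rule sum.remove) auto
  also have "(\<Sum>l\<in>UNIV - {k}. pdata S l * ?c l) = (\<Sum>l\<in>copilot S k - {k}. pdata S l *
          (cmod (\<Sum>m\<in>UNIV. cnj (a $ m) * complex_of_real (leak S m k l * beta S m l)))\<^sup>2)"
    \<comment> \<open>For \<open>l\<close> different from \<open>k\<close> the mean is
      \<open>leak\<close> times \<open>beta\<close>, which is zero outside the pilot group.\<close>
    by (rule sum.mono_neutral_cong_right) (auto simp: mr_mean_def leak_def intro: ccontr)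
  \<comment> \<open>The coherent term of user \<open>k\<close> is the desired power, which the
    definition of the interference subtracts.\<close>
  also have "pdata S k * ?c k = desired_power S (mr_mmse S k) a k"
    by (simp add: desired_power_eq mr_mean_own)
  finally have c: "(\<Sum>l\<in>UNIV. pdata S l * ?c l) = desired_power S (mr_mmse S k) a k
      + (\<Sum>l\<in>copilot S k - {k}. pdata S l *
          (cmod (\<Sum>m\<in>UNIV. cnj (a $ m) * complex_of_real (leak S m k l * beta S m l)))\<^sup>2)" .
  \<comment> \<open>The incoherent terms are regrouped by access point, so that the coefficient of
    |a_m|^2 can be read off.\<close>
  have "(\<Sum>l\<in>UNIV. pdata S l * (\<Sum>m\<in>UNIV. ?n m * (?e l m - (if l = k then (hbar S m k) ^ 4 else 0))))
      = (\<Sum>m\<in>UNIV. \<Sum>l\<in>UNIV. ?n m *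
          (pdata S l * ?e l m - (if l = k then pdata S k * (hbar S m k) ^ 4 else 0)))"
    unfolding sum_distrib_left by (subst sum.swap) (auto intro!: sum.cong simp: algebra_simps)
  also have "\<dots> = (\<Sum>m\<in>UNIV. ?n m * ((\<Sum>l\<in>UNIV. pdata S l * ?e l m) - pdata S k * (hbar S m k) ^ 4))"
    unfolding sum_distrib_left[symmetric] sum_subtractf by simp
  finally have e: "(\<Sum>l\<in>UNIV. pdata S l *
        (\<Sum>m\<in>UNIV. ?n m * (?e l m - (if l = k then (hbar S m k) ^ 4 else 0))))
      + sigma2 S * (\<Sum>m\<in>UNIV. ?n m * est_power S m k) = (\<Sum>m\<in>UNIV. ?n m * noise_weight k m)"
    unfolding noise_weight_def
    by (simp add: sum_distrib_left sum.distrib[symmetric] algebra_simps)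
  show ?thesis
    unfolding interference_noise_power_def combined_power filter_noise_power sinr_den_def
      e[symmetric] distrib_left sum.distrib c
    by simp
qed

lemma sinr_ul_eq:
  "sinr_ul S (mr_mmse S k) a k
     = pdata S k * (cmod (\<Sum>m\<in>UNIV. cnj (a $ m) * complex_of_real (est_power S m k)))\<^sup>2 / sinr_den k a"
  unfolding sinr_ul_def desired_power_eq interference_noise_power_eq ..

section \<open>The closed-form matrices as explicit diagonal matrices\<close>

lemma Lambda_mat_eq: "Lambda_mat S k = diag_mat (\<chi> m. complex_of_real (1 / lam S m k))"
  unfolding Lambda_mat_def using lam_pos[of _ k]
  by (subst matrix_inv_diag_mat) (auto simp: less_imp_neq[symmetric] divide_inverse)

lemma Z_mat_eq: "Z_mat S k = diag_mat (\<chi> m. complex_of_real (est_power S m k))"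
  unfolding Z_mat_def Omega_mat_def Lambda_mat_eq R_mat_def L_mat_def est_power_def
    diag_mat_mult diag_mat_scaleR diag_mat_add
  by (rule arg_cong[of _ _ diag_mat]) (simp add: vec_eq_iff power2_eq_square)

lemma R'_mat_eq: "R'_mat S l = diag_mat (\<chi> m. complex_of_real ((hbar S m l)\<^sup>2 + beta S m l))"
  unfolding R'_mat_def R_mat_def L_mat_def diag_mat_add
  by (rule arg_cong[of _ _ diag_mat]) (simp add: vec_eq_iff)

lemma b_vec_eq: "b_vec S k = (\<chi> m. complex_of_real (est_power S m k))"
  unfolding b_vec_def Z_mat_eq diag_vec_diag_mat ..

lemma cross_mat_eq: "R_mat S l ** Lambda_mat S k ** R_mat S k
    = diag_mat (\<chi> m. complex_of_real (beta S m l * beta S m k / lam S m k))"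
  unfolding Lambda_mat_eq R_mat_def diag_mat_mult
  by (rule arg_cong[of _ _ diag_mat]) (simp add: vec_eq_iff)

lemma z_vec_eq: "z_vec S k l = (\<chi> m. complex_of_real (beta S m l * beta S m k / lam S m k))"
  unfolding z_vec_def cross_mat_eq diag_vec_diag_mat ..

text \<open>The products of \<open>leak\<close> and \<open>beta\<close> are the entries of
  \<open>z_vec\<close> times a factor that is the same at all access points and leaves the
  modulus.\<close>

lemma leak_power_eq:
  assumes "l \<in> copilot S k"
  shows "pdata S l * (cmod (\<Sum>m\<in>UNIV. cnj (a $ m) * complex_of_real (leak S m k l * beta S m l)))\<^sup>2
       = pdata S l * phat S k * phat S l * (tau_p S)\<^sup>2 * (cmod (herm_inner a (z_vec S k l)))\<^sup>2"
proof -
  let ?q = "sqrt (phat S k) * sqrt (phat S l) * tau_p S"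
  have "(\<Sum>m\<in>UNIV. cnj (a $ m) * complex_of_real (leak S m k l * beta S m l))
      = complex_of_real ?q * herm_inner a (z_vec S k l)"
    using assms unfolding herm_inner_def z_vec_eq sum_distrib_left
    by (intro sum.cong) (auto simp: leak_def est_gain_def)
  moreover have "?q\<^sup>2 = phat S k * phat S l * (tau_p S)\<^sup>2"
    using phat_pos[of k] phat_pos[of l] by (simp add: power_mult_distrib less_imp_le)
  ultimately show ?thesis
    by (simp only: norm_mult norm_of_real power_mult_distrib power2_abs mult_ac)
qed

text \<open>The trace contains \<open>a\<close> where the combined signal contains its conjugate; as
  \<open>b_vec\<close> is real, the moduli agree.\<close>

lemma trace_Z: "cmod (trace (diag_mat a ** Z_mat S k)) = cmod (herm_inner a (b_vec S k))"
proof -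
  have "trace (diag_mat a ** Z_mat S k) = herm_inner (b_vec S k) a"
    unfolding Z_mat_eq b_vec_eq diag_mat_mult trace_diag_mat herm_inner_def by (simp add: mult.commute)
  then show ?thesis by (simp add: cmod_herm_inner_commute)
qed

lemma trace_cross:
  "cmod (trace (diag_mat a ** R_mat S l ** Lambda_mat S k ** R_mat S k))
     = cmod (herm_inner a (z_vec S k l))"
proof -
  have "trace (diag_mat a ** R_mat S l ** Lambda_mat S k ** R_mat S k)
      = trace (diag_mat a ** (R_mat S l ** Lambda_mat S k ** R_mat S k))"
    by (simp add: matrix_mul_assoc)
  also have "\<dots> = herm_inner (z_vec S k l) a"
    unfolding cross_mat_eq z_vec_eq diag_mat_mult trace_diag_mat herm_inner_def
    by (simp add: mult.commute)
  finally show ?thesis by (simp add: cmod_herm_inner_commute)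
qed

lemma sinr_den_alt:
  "sinr_den k a = (\<Sum>m\<in>UNIV. (cmod (a $ m))\<^sup>2 * noise_weight k m)
     + (\<Sum>l\<in>copilot S k - {k}. pdata S l * phat S k * phat S l * (tau_p S)\<^sup>2
          * (cmod (herm_inner a (z_vec S k l)))\<^sup>2)"
  unfolding sinr_den_def
  by (intro arg_cong2[where f = "(+)"] sum.cong refl leak_power_eq) auto

lemma trace_den_eq: "trace_den S a k = complex_of_real (sinr_den k a)"
proof -
  let ?A = "diag_mat a"
  have 1: "complex_of_real (pdata S l) * trace (ctransp ?A ** R'_mat S l ** Z_mat S k ** ?A)
      = complex_of_real (\<Sum>m\<in>UNIV. (cmod (a $ m))\<^sup>2 *
          (pdata S l * (est_power S m k * ((hbar S m l)\<^sup>2 + beta S m l))))" for l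
  proof -
    have "R'_mat S l ** Z_mat S k
        = diag_mat (\<chi> m. complex_of_real (est_power S m k * ((hbar S m l)\<^sup>2 + beta S m l)))"
      unfolding R'_mat_eq Z_mat_eq diag_mat_mult by (simp add: mult.commute)
    then show ?thesis
      unfolding matrix_mul_assoc[symmetric, of _ "R'_mat S l"]
      by (simp add: trace_diag_congruence sum_distrib_left mult.left_commute
          del: of_real_mult of_real_add of_real_power of_real_sum flip: of_real_mult)
  qed
  have "sigma2 S *\<^sub>R Z_mat S k - pdata S k *\<^sub>R (L_mat S k ** L_mat S k)
      = diag_mat (\<chi> m. complex_of_real (sigma2 S * est_power S m k - pdata S k * (hbar S m k) ^ 4))"
    unfolding Z_mat_eq L_mat_def diag_mat_mult diag_mat_scaleR diag_mat_diff
    by (rule arg_cong[of _ _ diag_mat]) (simp add: vec_eq_iff power4_eq_xxxx power2_eq_square mult_ac)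
  then have 2: "trace (ctransp ?A ** (sigma2 S *\<^sub>R Z_mat S k - pdata S k *\<^sub>R (L_mat S k ** L_mat S k)) ** ?A)
      = complex_of_real (\<Sum>m\<in>UNIV. (cmod (a $ m))\<^sup>2 *
          (sigma2 S * est_power S m k - pdata S k * (hbar S m k) ^ 4))"
    by (simp only: trace_diag_congruence)
  \<comment> \<open>\<open>noise_weight\<close> is regrouped as in the trace formula, with the
    subtracted fourth power joined to the noise term.\<close>
  have 3: "(\<Sum>m\<in>UNIV. (cmod (a $ m))\<^sup>2 * noise_weight k m)
     = (\<Sum>l\<in>UNIV. \<Sum>m\<in>UNIV. (cmod (a $ m))\<^sup>2 *
          (pdata S l * (est_power S m k * ((hbar S m l)\<^sup>2 + beta S m l))))
       + (\<Sum>m\<in>UNIV. (cmod (a $ m))\<^sup>2 * (sigma2 S * est_power S m k - pdata S k * (hbar S m k) ^ 4))"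
    unfolding noise_weight_def
    by (subst sum.swap)
       (simp only: sum_distrib_left[symmetric] sum.distrib[symmetric] distrib_left[symmetric]
         diff_add_eq add_diff_eq)
  show ?thesis
    unfolding trace_den_def Let_def 1 2 trace_cross sinr_den_alt 3
    by simp
qed

lemma Gamma_mat_eq:
  "Gamma_mat S k = diag_mat (\<chi> m. complex_of_real (noise_weight k m))
     + (\<Sum>l\<in>copilot S k - {k}.
          (pdata S l * phat S k * phat S l * (tau_p S)\<^sup>2) *\<^sub>R outer (z_vec S k l) (z_vec S k l))"
proof -
  have "(\<Sum>l\<in>UNIV. pdata S l *\<^sub>R (R'_mat S l ** Z_mat S k))
      - pdata S k *\<^sub>R (L_mat S k ** L_mat S k) + sigma2 S *\<^sub>R Z_mat S k
      = diag_mat (\<chi> m. complex_of_real (noise_weight k m))"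
    unfolding R'_mat_eq Z_mat_eq L_mat_def diag_mat_mult diag_mat_scaleR diag_mat_sum diag_mat_diff
      diag_mat_add
    by (rule arg_cong[of _ _ diag_mat])
       (simp add: vec_eq_iff noise_weight_def power4_eq_xxxx power2_eq_square mult_ac)
  then show ?thesis unfolding Gamma_mat_def by (simp add: algebra_simps)
qed

text \<open>Stated for two vectors because Hermitian symmetry and the Cauchy-Schwarz inequality
  concern the sesquilinear form.\<close>

lemma Gamma_form:
  "herm_inner x (Gamma_mat S k *v y)
     = (\<Sum>m\<in>UNIV. complex_of_real (noise_weight k m) * (cnj (x $ m) * y $ m))
       + (\<Sum>l\<in>copilot S k - {k}. complex_of_real (pdata S l * phat S k * phat S l * (tau_p S)\<^sup>2)
            * (herm_inner (z_vec S k l) y * herm_inner x (z_vec S k l)))"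
  unfolding Gamma_mat_eq matrix_vector_mult_add_rdistrib herm_inner_add herm_inner_diag_mat
    matrix_mult_vec_sum herm_inner_sum scaleR_matrix_mult_vec herm_inner_scale outer_mult_vec ..

lemma Gamma_quadratic_form: "herm_inner a (Gamma_mat S k *v a) = complex_of_real (sinr_den k a)"
proof -
  have "herm_inner (z_vec S k l) a * herm_inner a (z_vec S k l)
      = complex_of_real ((cmod (herm_inner a (z_vec S k l)))\<^sup>2)" for l
    unfolding complex_norm_square cnj_herm_inner by (rule mult.commute)
  moreover have "cnj (a $ m) * a $ m = complex_of_real ((cmod (a $ m))\<^sup>2)" for m
    unfolding complex_norm_square by (rule mult.commute)
  ultimately show ?thesis
    unfolding Gamma_form sinr_den_alt by (simp add: mult.commute)
qed

sublocale Gamma: pos_def "Gamma_mat S k" for k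
proof
  show "herm_inner x (Gamma_mat S k *v y) = cnj (herm_inner y (Gamma_mat S k *v x))" for x y
    unfolding Gamma_form by (simp add: cnj_herm_inner mult.commute)
  show "0 < Re (herm_inner x (Gamma_mat S k *v x))" if "x \<noteq> 0" for x
    using sinr_den_pos[OF that] by (simp add: Gamma_quadratic_form)
qed

lemma sinr_ul_herm:
  "sinr_ul S (mr_mmse S k) a k
     = pdata S k * (cmod (herm_inner a (b_vec S k)))\<^sup>2 / sinr_den k a"
  unfolding sinr_ul_eq b_vec_eq herm_inner_def by simp

lemma sinr_mmse_eq: "sinr_mmse S a k = complex_of_real (sinr_ul S (mr_mmse S k) a k)"
  unfolding sinr_mmse_def sinr_ul_herm trace_Z trace_den_eq by simp

lemma sinr_rayleigh_eq: "sinr_rayleigh S a k = complex_of_real (sinr_ul S (mr_mmse S k) a k)"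
  unfolding sinr_rayleigh_def sinr_ul_herm herm_inner_outer Gamma_quadratic_form
  by (simp add: cmod_herm_inner_commute)

section \<open>Optimality of the decoding vector\<close>

lemma b_vec_nonzero: "b_vec S k \<noteq> 0"
  using est_power_pos[of _ k] by (simp add: b_vec_eq vec_eq_iff less_imp_neq[symmetric])

lemma lsfd_opt_nonzero: "lsfd_opt S k \<noteq> 0"
  unfolding lsfd_opt_def by (rule Gamma.inv_nonzero[OF b_vec_nonzero])

lemma Gamma_lsfd_opt: "Gamma_mat S k *v lsfd_opt S k = b_vec S k"
  unfolding lsfd_opt_def by (rule Gamma.inv_cancel)

text \<open>\<open>b_vec\<close> is \<open>Gamma_mat\<close> applied to \<open>lsfd_opt\<close>, so
  this product is the conjugate of a value of the real quadratic form.\<close>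

lemma herm_inner_b_lsfd_opt:
  "herm_inner (b_vec S k) (lsfd_opt S k) = complex_of_real (sinr_den k (lsfd_opt S k))"
  using arg_cong[OF Gamma_quadratic_form[of "lsfd_opt S k" k], of cnj]
  unfolding Gamma_lsfd_opt cnj_herm_inner by simp

text \<open>At the optimum the numerator is \<open>pdata\<close> times the square of the
  denominator, so one factor cancels.\<close>

lemma sinr_ul_lsfd_opt:
  "sinr_ul S (mr_mmse S k) (lsfd_opt S k) k = pdata S k * sinr_den k (lsfd_opt S k)"
  unfolding sinr_ul_herm cmod_herm_inner_commute[of "lsfd_opt S k"] herm_inner_b_lsfd_opt
  using sinr_den_pos[OF lsfd_opt_nonzero, of k] by (simp add: power2_eq_square)

text \<open>Cauchy-Schwarz for the form of \<open>Gamma_mat\<close>, applied to \<open>a\<close> and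
  \<open>lsfd_opt\<close>: the left product becomes the one of \<open>a\<close> with
  \<open>b_vec\<close>.\<close>

lemma sinr_ul_le_lsfd_opt:
  assumes "a \<noteq> 0"
  shows "sinr_ul S (mr_mmse S k) a k \<le> sinr_ul S (mr_mmse S k) (lsfd_opt S k) k"
proof -
  have "(cmod (herm_inner a (b_vec S k)))\<^sup>2 \<le> sinr_den k a * sinr_den k (lsfd_opt S k)"
    using Gamma.cauchy_schwarz[of a k "lsfd_opt S k"]
    unfolding Gamma_quadratic_form unfolding Gamma_lsfd_opt by simp
  from mult_left_mono[OF this pdata_nonneg[of k]] show ?thesis
    unfolding sinr_ul_lsfd_opt unfolding sinr_ul_herm
    using sinr_den_pos[OF assms, of k] by (simp add: divide_le_eq mult_ac)
qed

lemma sinr_ul_nonneg: "a \<noteq> 0 \<Longrightarrow> 0 \<le> sinr_ul S (mr_mmse S k) a k"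
  unfolding sinr_ul_herm using sinr_den_pos[of a k] pdata_nonneg[of k] by simp

text \<open>The logarithm is monotone here because nonnegative SINRs keep both arguments
  positive.\<close>

lemma SE_ul_le_lsfd_opt:
  assumes "a \<noteq> 0"
  shows "SE_ul S (mr_mmse S k) a k \<le> SE_ul S (mr_mmse S k) (lsfd_opt S k) k"
  unfolding SE_ul_def
  using sinr_ul_le_lsfd_opt[OF assms, of k] sinr_ul_nonneg[OF assms, of k]
  by (intro mult_left_mono) auto

end

text \<open>The nonzero denominators guarantee that no quotient takes its default value, the
  membership in the reals that \<open>Re\<close> loses nothing, and
  \<open>lsfd_opt S k \<noteq> 0\<close> that the maximizer is itself admissible.\<close>

theorem theorem1:
  fixes S :: "('m::finite, 'k::finite, 't::finite, 'w) uplink"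
    and k :: 'k
  assumes "cell_free_uplink S"
  shows "(\<forall>a :: complex^'m. a \<noteq> 0 \<longrightarrow>
            interference_noise_power S (mr_mmse S k) a k \<noteq> 0 \<and>
            trace_den S a k \<noteq> 0 \<and>
            herm_inner a (Gamma_mat S k *v a) \<noteq> 0 \<and>
            sinr_mmse S a k \<in> \<real> \<and>
            SE_ul S (mr_mmse S k) a k =
              real (tau_u S) / real (tau_c S) * log 2 (1 + Re (sinr_mmse S a k)) \<and>
            sinr_mmse S a k = sinr_rayleigh S a k)
       \<and> invertible (Gamma_mat S k)
       \<and> lsfd_opt S k \<noteq> 0
       \<and> (\<forall>a :: complex^'m. a \<noteq> 0 \<longrightarrow>
            SE_ul S (mr_mmse S k) a k \<le> SE_ul S (mr_mmse S k) (lsfd_opt S k) k)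
       \<and> herm_inner (b_vec S k) (matrix_inv (Gamma_mat S k) *v b_vec S k) \<in> \<real>
       \<and> SE_ul S (mr_mmse S k) (lsfd_opt S k) k =
            real (tau_u S) / real (tau_c S) *
            log 2 (1 + pdata S k *
              Re (herm_inner (b_vec S k) (matrix_inv (Gamma_mat S k) *v b_vec S k)))"
proof -
  interpret cell_free_uplink S by fact
  have 1: "interference_noise_power S (mr_mmse S k) a k \<noteq> 0 \<and>
            trace_den S a k \<noteq> 0 \<and>
            herm_inner a (Gamma_mat S k *v a) \<noteq> 0 \<and>
            sinr_mmse S a k \<in> \<real> \<and>
            SE_ul S (mr_mmse S k) a k =
              real (tau_u S) / real (tau_c S) * log 2 (1 + Re (sinr_mmse S a k)) \<and>
            sinr_mmse S a k = sinr_rayleigh S a k" if "a \<noteq> 0" for a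
    using sinr_den_pos[OF that, of k]
    by (simp add: interference_noise_power_eq trace_den_eq Gamma_quadratic_form sinr_mmse_eq
        sinr_rayleigh_eq SE_ul_def)
  have 2: "SE_ul S (mr_mmse S k) (lsfd_opt S k) k = real (tau_u S) / real (tau_c S) *
      log 2 (1 + pdata S k * Re (herm_inner (b_vec S k) (lsfd_opt S k)))"
    by (simp add: SE_ul_def sinr_ul_lsfd_opt herm_inner_b_lsfd_opt)
  have 3: "herm_inner (b_vec S k) (lsfd_opt S k) \<in> \<real>"
    by (simp add: herm_inner_b_lsfd_opt)
  show ?thesis
    unfolding lsfd_opt_def[symmetric]
    using 1 SE_ul_le_lsfd_opt by (intro conjI Gamma.invertible lsfd_opt_nonzero 2 3) blast+
qed

end
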